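(* Suppose that: $(X,Y),(X_1,Y_1),\dots,(X_n,Y_n)$ are i.i.d.; the prototypes $Z,Z_1,\dots,Z_m$ are i.i.d. with the same law as $X$ and independent of $(X,Y),(X_i,Y_i)_{i\le n}$; $g$ is $L$-Lipschitz on $S_X$; $\varepsilon=Y-g(X)$ is sub-Gaussian conditionally on $X$ and $Z$ with parameter $\sigma^2$; and the regularity assumption on $S_X$ and on the density $f_X$ given in the context holds, with constants $c_d,T_0,b,M$. If $\delta\in(0,1/4)$, $n\ge1$, $m\ge1$ and $\eta>0$ are such that $$32d\log(12m/\delta)\le T_0^d\,m\,b\,c_d\,V_d,\qquad\eta\le2T_0\qquad\text{and}\qquad n\,b\,V_d\,c_d\,\eta^d\ge2^{d+3}\log(1/\delta),$$ then for all $x\in S_X$, with probability at least $1-4\delta$, $$|\hat g_{\mathrm{opt}}(x)-g(x)|\le\sqrt{\frac{2^{d+2}\sigma^2\log(1/\delta)}{n\,b\,V_d\,c_d\,\eta^d}}+2L(\mathcal V_\eta(x))\left\{\eta+\left(\frac{32d\log(12m/\delta)}{m\,b\,c_d\,V_d}\right)^{1/d}\right\}.$$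
   Context: Setting: $d\ge1$; $(X,Y)$ is a random vector in $\mathbb R^d\times\mathbb R$, $X$ takes values in $S_X\subset\mathbb R^d$, $g(x)=\mathbb E[Y\mid X=x]$, $\varepsilon=Y-g(X)$. $\lambda$ is Lebesgue measure, $B(x,\tau)$ the Euclidean ball, $V_d$ the Lebesgue volume of the unit Euclidean ball in $\mathbb R^d$. Sub-Gaussian conditionally on $X$ and $Z$ with parameter $\sigma^2$: $\mathbb E[\varepsilon\mid X,Z]=0$ and $\mathbb E[\exp(t\varepsilon)\mid X,Z]\le\exp(t^2\sigma^2/2)$ a.s. for all $t\in\mathbb R$. Regularity assumption: there is $\rho_0>0$ with $S_X\subset B(0,\rho_0)$; there are $c_d>0$ and $T_0>0$ such that $\lambda(S_X\cap B(x,\tau))\ge c_d\lambda(B(x,\tau))$ for all $\tau\in(0,T_0]$ and $x\in S_X$, where (as can be arranged by changing $c_d$) $T_0=\rho_0$; and $X$ has a density $f_X$ on $S_X$ with $0<b\le f_X(x)\le M<\infty$ for $x\in S_X$. OptiNet: let $Z(\eta)=\{Z_1(\eta),\dots,Z_{m(\eta)}(\eta)\}$ be an $\eta$-net of $\{Z_1,\dots,Z_m\}$, i.e. a subset whose distinct points are at Euclidean distance $>\eta$ from each other and which is maximal for this property (chosen as a function of $Z_1,\dots,Z_m$). Let $\mathcal V_\eta(x)\subset S_X$ be the Voronoi cell containing $x$ in the partition of $S_X$ according to the nearest point among $Z(\eta)$ (ties broken by a fixed rule, e.g. larger index). The estimator is $$\hat g_{\mathrm{opt}}(x)=\frac{\sum_{i=1}^nY_i\mathbf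 1_{\mathcal V_\eta(x)}(X_i)}{\sum_{i=1}^n\mathbf 1_{\mathcal V_\eta(x)}(X_i)},\qquad0/0=0.$$ For $V\subset S_X$, $L(V)$ is the smallest constant such that $|g(y)-g(z)|\le L(V)\|y-z\|_2$ for all $y,z\in V$. *)

theory Defs
  imports "HOL-Probability.Probability"
begin

text \<open>Index 0 of a family of random vectors is used for the generic copy, and the indices from 1
  on for the sample: \<open>X 0, Y 0, Z 0\<close> stand for \<open>X, Y, Z\<close>.\<close>

text \<open>Conditional expectation given a random vector is conditional expectation given the
  sigma-algebra it generates.\<close>

abbreviation sigma_gen :: "'w measure \<Rightarrow> ('w \<Rightarrow> 'b::topological_space) \<Rightarrow> 'w measure" where
  "sigma_gen P U \<equiv> vimage_algebra (space P) U borel"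

definition regression_function ::
    "'w measure \<Rightarrow> ('w \<Rightarrow> 'a::euclidean_space) \<Rightarrow> ('w \<Rightarrow> real) \<Rightarrow> ('a \<Rightarrow> real) \<Rightarrow> bool" where
  "regression_function P X Y g \<longleftrightarrow>
     integrable P Y \<and> (AE \<omega> in P. real_cond_exp P (sigma_gen P X) Y \<omega> = g (X \<omega>))"

definition identically_distributed ::
    "'w measure \<Rightarrow> (nat \<Rightarrow> 'w \<Rightarrow> 'b::topological_space) \<Rightarrow> nat set \<Rightarrow> bool" where
  "identically_distributed P U I \<longleftrightarrow>
     (\<forall>i\<in>I. \<forall>j\<in>I. distr P borel (U i) = distr P borel (U j))"

definition iid ::
    "'w measure \<Rightarrow> (nat \<Rightarrow> 'w \<Rightarrow> 'b::topological_space) \<Rightarrow> nat set \<Rightarrow> bool" where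
  "iid P U I \<longleftrightarrow>
     prob_space.indep_vars P (\<lambda>_. borel) U I \<and> identically_distributed P U I"

text \<open>Independence of the vector \<open>(U i)\<close>, \<open>i \<in> I\<close>, and the vector \<open>(W j)\<close>, \<open>j \<in> J\<close>, expressed
  through the generated sigma-algebras because \<^term>\<open>prob_space.indep_var\<close> requires both
  vectors to have the same type.\<close>

definition indep_families ::
    "'w measure \<Rightarrow> (nat \<Rightarrow> 'w \<Rightarrow> 'b::topological_space) \<Rightarrow> nat set \<Rightarrow>
       (nat \<Rightarrow> 'w \<Rightarrow> 'c::topological_space) \<Rightarrow> nat set \<Rightarrow> bool" where
  "indep_families P U I W J \<longleftrightarrow>
     prob_space.indep_set P
       (sets (vimage_algebra (space P) (\<lambda>\<omega>. \<lambda>i\<in>I. U i \<omega>) (PiM I (\<lambda>_. borel))))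
       (sets (vimage_algebra (space P) (\<lambda>\<omega>. \<lambda>j\<in>J. W j \<omega>) (PiM J (\<lambda>_. borel))))"

text \<open>The exponential moment uses \<^const>\<open>nn_cond_exp\<close>, with values in \<^typ>\<open>ennreal\<close>:
  \<^const>\<open>real_cond_exp\<close> would turn an infinite conditional expectation into 0.\<close>

definition subgaussian_given :: "'w measure \<Rightarrow> 'w measure \<Rightarrow> real \<Rightarrow> ('w \<Rightarrow> real) \<Rightarrow> bool" where
  "subgaussian_given P F v \<epsilon> \<longleftrightarrow>
     integrable P \<epsilon> \<and>
     (AE \<omega> in P. real_cond_exp P F \<epsilon> \<omega> = 0) \<and>
     (\<forall>t::real. AE \<omega> in P.
        nn_cond_exp P F (\<lambda>\<omega>'. ennreal (exp (t * \<epsilon> \<omega>'))) \<omega> \<le> ennreal (exp (t\<^sup>2 * v / 2)))"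

definition separated :: "real \<Rightarrow> 'a::metric_space set \<Rightarrow> bool" where
  "separated \<eta> N \<longleftrightarrow> (\<forall>p\<in>N. \<forall>q\<in>N. p \<noteq> q \<longrightarrow> dist p q > \<eta>)"

definition eta_net :: "real \<Rightarrow> 'a::metric_space set \<Rightarrow> 'a set \<Rightarrow> bool" where
  "eta_net \<eta> A N \<longleftrightarrow>
     N \<subseteq> A \<and> separated \<eta> N \<and> (\<forall>N'. N \<subset> N' \<and> N' \<subseteq> A \<longrightarrow> \<not> separated \<eta> N')"

text \<open>A choice of an \<open>\<eta>\<close>-net as a measurable function of the prototypes \<open>z 1, \<dots>, z m\<close>.
  It returns the list of indices of the retained prototypes, so that the points
  \<open>map z (sel z)\<close> are an enumeration, in an arbitrary order, of the net.\<close>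

definition net_selector ::
    "real \<Rightarrow> nat \<Rightarrow> ((nat \<Rightarrow> 'a::euclidean_space) \<Rightarrow> nat list) \<Rightarrow> bool" where
  "net_selector \<eta> m sel \<longleftrightarrow>
     sel \<in> measurable (PiM {1..m} (\<lambda>_. borel)) (count_space UNIV) \<and>
     (\<forall>z \<in> space (PiM {1..m} (\<lambda>_. borel)).
        set (sel z) \<subseteq> {1..m} \<and> distinct (map z (sel z)) \<and>
        eta_net \<eta> (z ` {1..m}) (set (map z (sel z))))"

definition net_points ::
    "((nat \<Rightarrow> 'a) \<Rightarrow> nat list) \<Rightarrow> nat \<Rightarrow> (nat \<Rightarrow> 'a) \<Rightarrow> 'a list" where
  "net_points sel m z = (let z' = restrict z {1..m} in map z' (sel z'))"

text \<open>Fixed rule for breaking ties: it picks one index out of any set of tied indices,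
  for instance \<^const>\<open>Max\<close>.\<close>

definition tie_rule :: "(nat set \<Rightarrow> nat) \<Rightarrow> bool" where
  "tie_rule \<kappa> \<longleftrightarrow> (\<forall>T. finite T \<and> T \<noteq> {} \<longrightarrow> \<kappa> T \<in> T)"

definition nearest_index :: "(nat set \<Rightarrow> nat) \<Rightarrow> 'a::metric_space list \<Rightarrow> 'a \<Rightarrow> nat" where
  "nearest_index \<kappa> ps y =
     \<kappa> {k. k < length ps \<and> (\<forall>l < length ps. dist y (ps ! k) \<le> dist y (ps ! l))}"

definition voronoi_cell ::
    "(nat set \<Rightarrow> nat) \<Rightarrow> 'a::metric_space set \<Rightarrow> 'a list \<Rightarrow> 'a \<Rightarrow> 'a set" where
  "voronoi_cell \<kappa> S ps x = {y \<in> S. nearest_index \<kappa> ps y = nearest_index \<kappa> ps x}"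

text \<open>The convention \<open>0/0 = 0\<close> is that of division on the reals.\<close>

definition local_average :: "nat \<Rightarrow> (nat \<Rightarrow> 'a) \<Rightarrow> (nat \<Rightarrow> real) \<Rightarrow> 'a set \<Rightarrow> real" where
  "local_average n xs ys V =
     (\<Sum>i=1..n. ys i * indicator V (xs i)) / (\<Sum>i=1..n. indicator V (xs i))"

text \<open>The library predicate \<open>C-lipschitz_on V g\<close> includes \<open>0 \<le> C\<close>, so that the constant is 0 on
  a one-point set.  The minimum exists whenever \<open>g\<close> is Lipschitz on \<open>V\<close>.\<close>

definition lip_const :: "('a::metric_space \<Rightarrow> real) \<Rightarrow> 'a set \<Rightarrow> real" where
  "lip_const g V = (LEAST C. C-lipschitz_on V g)"

end

theory Submission
  imports Defs
begin

text \<open>Three events fail with small probability. With \<open>\<tau>\<close> the \<open>d\<close>-th root in the bound, every point of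
  \<open>S\<close> is within \<open>\<tau>\<close> of a prototype, except with probability \<open>\<delta>\<close>: this follows from a union bound
  over a maximal packing of \<open>S\<close>, whose size is polynomial in \<open>m\<close> because the condition on \<open>m\<close>
  forces \<open>m \<ge> 4 d\<close>. On this event every point of a Voronoi cell is within \<open>\<eta> + \<tau>\<close> of its center, so
  the bias is at most \<open>2 (\<eta> + \<tau>)\<close> times the Lipschitz constant of \<open>g\<close> on the cell. Since the net is
  \<open>\<eta>\<close>-separated, the cell contains the points of \<open>S\<close> in a ball of radius \<open>\<eta> / 2\<close>, hence has mass at
  least \<open>q = b c V\<^sub>d (\<eta> / 2)\<^sup>d\<close>. Given the prototypes the cell is a fixed set, independent of the
  sample; by Chernoff's bound it contains at least \<open>n q / 2\<close> sample points except with probability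
  \<open>\<delta>\<close>, and given their number \<open>N\<close> the noise sum is at most the square root of
  \<open>2 \<sigma>\<^sup>2 N ln (1 / \<delta>)\<close> in absolute value except with probability \<open>2 \<delta>\<close>.\<close>

section \<open>Tail bounds for sums over a random set of indices\<close>

text \<open>Chernoff's method restricted to an event: the factor \<open>emeasure M A\<close>
  survives on both sides, so that bounds for disjoint events can be added without loss. For
  \<open>a > 0\<close> the exponent is optimized; for \<open>a = 0\<close> the threshold is 0 and
  the strict inequality is essential.\<close>

lemma (in prob_space) subgaussian_upper_tail:
  fixes S :: "'a \<Rightarrow> real"
  assumes [measurable]: "A \<in> events" "S \<in> borel_measurable M"
    and "0 \<le> a" "0 < \<delta>" "\<delta> < 1"
    and mgf: "\<And>t. (\<integral>\<^sup>+\<omega>. ennreal (exp (t * S \<omega>)) * indicator A \<omega> \<partial>M)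
                \<le> ennreal (exp (t\<^sup>2 * a / 2)) * emeasure M A"
  shows "emeasure M {\<omega>\<in>A. sqrt (2 * a * ln (1 / \<delta>)) < S \<omega>} \<le> ennreal \<delta> * emeasure M A"
proof -
  have tail: "emeasure M {\<omega>\<in>A. r \<le> S \<omega>} \<le> ennreal (exp (t\<^sup>2 * a / 2 - t * r)) * emeasure M A"
    if "t > 0" for t r
  proof -
    have "emeasure M {\<omega>\<in>A. r \<le> S \<omega>}
        \<le> ennreal (exp (- t * r)) * (\<integral>\<^sup>+\<omega>. ennreal (exp (t * S \<omega>)) * indicator A \<omega> \<partial>M)"
      using Chernoff_ineq_nn_integral_ge[OF that, of A M S r] by simp
    also have "\<dots> \<le> ennreal (exp (- t * r)) * (ennreal (exp (t\<^sup>2 * a / 2)) * emeasure M A)"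
      by (intro mult_left_mono mgf) simp
    also have "\<dots> = ennreal (exp (t\<^sup>2 * a / 2 - t * r)) * emeasure M A"
      by (simp add: mult.assoc[symmetric] ennreal_mult[symmetric] exp_add[symmetric])
    finally show ?thesis .
  qed
  show ?thesis
  proof (cases "a = 0")
    case True
    \<comment> \<open>For \<open>a = 0\<close> the probability is at most
      \<open>exp (- t * r)\<close> for all \<open>t > 0\<close>. Instead of a limit,
      \<open>t = 1 / (r * x)\<close> with \<open>x\<close> the probability in question gives
      \<open>x \<le> exp (- 1 / x)\<close>, against \<open>1 / x < exp (1 / x)\<close>.\<close>
    have "prob {\<omega>\<in>A. r \<le> S \<omega>} = 0" if "r > 0" for r
    proof (rule ccontr)
      let ?x = "prob {\<omega>\<in>A. r \<le> S \<omega>}"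
      assume "?x \<noteq> 0"
      then have x: "?x > 0" by (simp add: zero_less_measure_iff)
      have "emeasure M {\<omega>\<in>A. r \<le> S \<omega>} \<le> ennreal (exp (- 1 / ?x)) * emeasure M A"
        using tail[of "1 / (r * ?x)" r] x that True by simp
      also have "\<dots> \<le> ennreal (exp (- 1 / ?x)) * 1"
        by (intro mult_left_mono) (simp_all add: emeasure_eq_measure)
      finally have "?x \<le> exp (- 1 / ?x)" by (simp add: emeasure_eq_measure)
      moreover have "1 / ?x < exp (1 / ?x)" using exp_ge_add_one_self[of "1 / ?x"] by linarith
      then have "exp (- 1 / ?x) < ?x" using x by (simp add: exp_minus field_simps)
      ultimately show False by simp
    qed
    then have "AE \<omega> in M. \<omega> \<notin> {\<omega>\<in>A. 1 / real (Suc k) \<le> S \<omega>}" for k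
      by (intro AE_not_in) (simp add: null_sets_def emeasure_eq_measure del: of_nat_Suc)
    then have "AE \<omega> in M. \<forall>k. \<omega> \<notin> {\<omega>\<in>A. 1 / real (Suc k) \<le> S \<omega>}"
      by (simp only: AE_all_countable simp_thms)
    then have "AE \<omega> in M. \<omega> \<notin> {\<omega>\<in>A. sqrt (2 * a * ln (1 / \<delta>)) < S \<omega>}"
    proof (rule AE_mp, intro AE_I2 impI)
      fix \<omega> assume *: "\<forall>k. \<omega> \<notin> {\<omega>\<in>A. 1 / real (Suc k) \<le> S \<omega>}"
      show "\<omega> \<notin> {\<omega>\<in>A. sqrt (2 * a * ln (1 / \<delta>)) < S \<omega>}"
      proof
        assume "\<omega> \<in> {\<omega>\<in>A. sqrt (2 * a * ln (1 / \<delta>)) < S \<omega>}"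
        then have "\<omega> \<in> A" "0 < S \<omega>" using True by auto
        with * show False using nat_approx_posE[of "S \<omega>"] by (metis (no_types, lifting) less_imp_le mem_Collect_eq)
      qed
    qed
    then have "emeasure M {\<omega>\<in>A. sqrt (2 * a * ln (1 / \<delta>)) < S \<omega>} = 0"
      by (subst (asm) AE_iff_null_sets[symmetric]) auto
    then show ?thesis by simp
  next
    case False
    define l where "l = ln (1 / \<delta>)"
    define r where "r = sqrt (2 * a * l)"
    have l: "l > 0" using assms unfolding l_def by simp
    have a: "a > 0" using assms False by simp
    have r: "r > 0" "r\<^sup>2 = 2 * a * l" unfolding r_def using a l by auto
    \<comment> \<open>\<open>t = r / a\<close> minimizes \<open>t\<^sup>2 * a / 2 - t * r\<close>;
      the threshold \<open>r\<close> is chosen so that the minimum is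
      \<open>- ln (1 / \<delta>)\<close>.\<close>
    have "(r / a)\<^sup>2 * a / 2 - r / a * r = - (r\<^sup>2 / (2 * a))"
      using a by (simp add: field_simps power2_eq_square)
    also have "\<dots> = - l" unfolding r using a by simp
    finally have "exp ((r / a)\<^sup>2 * a / 2 - r / a * r) = \<delta>"
      using assms by (simp add: l_def ln_div)
    then have "emeasure M {\<omega>\<in>A. r \<le> S \<omega>} \<le> ennreal \<delta> * emeasure M A"
      using tail[of "r / a" r] r a by simp
    moreover have "emeasure M {\<omega>\<in>A. r < S \<omega>} \<le> emeasure M {\<omega>\<in>A. r \<le> S \<omega>}"
      by (intro emeasure_mono) auto
    ultimately show ?thesis unfolding r_def l_def by (rule order_trans[rotated])
  qed
qed

text \<open>On the event that exactly the indices in \<open>J\<close> fall into \<open>A\<close>,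
  the exponential of the sum is a product of functions of the single \<open>D i\<close>, and
  independence factorizes its integral. At \<open>t = 0\<close> the formula evaluates the
  probability of that event.\<close>

lemma (in prob_space) nn_integral_exp_occupancy_pattern:
  fixes e :: "'b \<Rightarrow> real"
  assumes I: "finite I" "J \<subseteq> I" and indep: "indep_vars (\<lambda>_. N) D I"
    and [measurable]: "A \<in> sets N" "e \<in> borel_measurable N"
  shows "(\<integral>\<^sup>+\<omega>. ennreal (exp (t * (\<Sum>i\<in>J. e (D i \<omega>)))) *
             indicator {\<omega>\<in>space M. \<forall>i\<in>I. D i \<omega> \<in> A \<longleftrightarrow> i \<in> J} \<omega> \<partial>M)
       = (\<Prod>i\<in>J. \<integral>\<^sup>+\<omega>. ennreal (exp (t * e (D i \<omega>))) * indicator A (D i \<omega>) \<partial>M) *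
         (\<Prod>i\<in>I - J. \<integral>\<^sup>+\<omega>. indicator (- A) (D i \<omega>) \<partial>M)"
proof -
  \<comment> \<open>\<open>1 - indicator A\<close> is measurable as soon as \<open>A\<close> is,
    whereas \<open>- A\<close> need not belong to \<open>sets N\<close>.\<close>
  define h :: "'c \<Rightarrow> 'b \<Rightarrow> ennreal" where "h = (\<lambda>i x. if i \<in> J then ennreal (exp (t * e x)) * indicator A x
      else 1 - indicator A x)"
  have hm: "h i \<in> borel_measurable N" for i
    unfolding h_def by (cases "i \<in> J") auto
  have J: "finite J" using I finite_subset by blast
  have 1: "1 - indicator A x = (indicator (- A) x :: ennreal)" for x
    by (simp split: split_indicator)
  have prod_indicator: "(\<Prod>i\<in>K. indicator B (D i \<omega>)) = (if \<forall>i\<in>K. D i \<omega> \<in> B then 1 else (0 :: ennreal))"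
    if "finite K" for K B \<omega>
    using that by (induction K rule: finite_induct) (auto split: split_indicator)
  have eq: "ennreal (exp (t * (\<Sum>i\<in>J. e (D i \<omega>)))) *
             indicator {\<omega>\<in>space M. \<forall>i\<in>I. D i \<omega> \<in> A \<longleftrightarrow> i \<in> J} \<omega> = (\<Prod>i\<in>I. h i (D i \<omega>))"
    if "\<omega> \<in> space M" for \<omega>
  proof -
    have "(\<Prod>i\<in>I. h i (D i \<omega>)) = (\<Prod>i\<in>J. h i (D i \<omega>)) * (\<Prod>i\<in>I - J. h i (D i \<omega>))"
      using prod.subset_diff[OF I(2,1), of "\<lambda>i. h i (D i \<omega>)"] by (simp add: mult.commute)
    also have "(\<Prod>i\<in>J. h i (D i \<omega>)) = ennreal (exp (t * (\<Sum>i\<in>J. e (D i \<omega>)))) * (\<Prod>i\<in>J. indicator A (D i \<omega>))"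
      using J by (simp add: h_def prod.distrib prod_ennreal sum_distrib_left exp_sum)
    also have "(\<Prod>i\<in>I - J. h i (D i \<omega>)) = (\<Prod>i\<in>I - J. indicator (- A) (D i \<omega>))"
      by (simp add: h_def 1)
    finally show ?thesis using I that J prod_indicator[of J A] prod_indicator[of "I - J" "- A"]
      by (auto split: split_indicator)
  qed
  have "(\<integral>\<^sup>+\<omega>. ennreal (exp (t * (\<Sum>i\<in>J. e (D i \<omega>)))) *
             indicator {\<omega>\<in>space M. \<forall>i\<in>I. D i \<omega> \<in> A \<longleftrightarrow> i \<in> J} \<omega> \<partial>M)
      = (\<integral>\<^sup>+\<omega>. (\<Prod>i\<in>I. h i (D i \<omega>)) \<partial>M)"
    by (intro nn_integral_cong eq)
  also have "\<dots> = (\<Prod>i\<in>I. \<integral>\<^sup>+\<omega>. h i (D i \<omega>) \<partial>M)"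
    by (intro indep_vars_nn_integral I indep_vars_compose2[OF indep] hm) auto
  also have "\<dots> = (\<Prod>i\<in>J. \<integral>\<^sup>+\<omega>. h i (D i \<omega>) \<partial>M) * (\<Prod>i\<in>I - J. \<integral>\<^sup>+\<omega>. h i (D i \<omega>) \<partial>M)"
    using prod.subset_diff[OF I(2,1)] by (simp add: mult.commute)
  finally show ?thesis by (simp add: h_def 1)
qed

text \<open>The sum over \<open>A\<close> has a random number of terms. It is split according to the set of
  indices \<open>i\<close> with \<open>D i \<in> A\<close>; on each piece the number of terms is deterministic.\<close>

lemma (in prob_space) subgaussian_sum_over_set_tail:
  fixes e :: "'b \<Rightarrow> real"
  assumes I: "finite I" and indep: "indep_vars (\<lambda>_. N) D I"
    and [measurable]: "A \<in> sets N" "e \<in> borel_measurable N"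
    and "0 \<le> v" "0 < \<delta>" "\<delta> < 1"
    and mgf: "\<And>i t. i \<in> I \<Longrightarrow>
      (\<integral>\<^sup>+\<omega>. ennreal (exp (t * e (D i \<omega>))) * indicator A (D i \<omega>) \<partial>M)
        \<le> ennreal (exp (t\<^sup>2 * v / 2)) * (\<integral>\<^sup>+\<omega>. indicator A (D i \<omega>) \<partial>M)"
  shows "emeasure M {\<omega>\<in>space M. sqrt (2 * v * ln (1 / \<delta>) * (\<Sum>i\<in>I. indicator A (D i \<omega>)))
            < \<bar>\<Sum>i\<in>I. e (D i \<omega>) * indicator A (D i \<omega>)\<bar>} \<le> ennreal (2 * \<delta>)"
    (is "emeasure M ?B \<le> _")
proof -
  have D[measurable]: "D i \<in> measurable M N" if "i \<in> I" for i
    using indep that by (auto simp: indep_vars_def)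
  define Q where "Q J = {\<omega>\<in>space M. \<forall>i\<in>I. D i \<omega> \<in> A \<longleftrightarrow> i \<in> J}" for J
  have Q[measurable]: "Q J \<in> events" for J
  proof -
    have "Measurable.pred M (\<lambda>\<omega>. \<forall>i\<in>I. D i \<omega> \<in> A \<longleftrightarrow> i \<in> J)"
      using I by (intro pred_intros_finite) auto
    then show ?thesis unfolding Q_def by measurable
  qed
  define S where "S J \<omega> = (\<Sum>i\<in>J. e (D i \<omega>))" for J \<omega>
  have S[measurable]: "S J \<in> borel_measurable M" if "J \<in> Pow I" for J
    unfolding S_def using that by (intro borel_measurable_sum) auto
  have fin: "finite J" if "J \<in> Pow I" for J using that I finite_subset by blast
  let ?r = "\<lambda>J. sqrt (2 * (real (card J) * v) * ln (1 / \<delta>))"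
  \<comment> \<open>The sign \<open>s\<close> is 1 or -1, for the two one-sided deviations; it
    disappears from the moment bound because only its square enters there.\<close>
  define T where "T s J = {\<omega>\<in>Q J. ?r J < s * S J \<omega>}" for s J
  have T[measurable]: "T s J \<in> events" if "J \<in> Pow I" for J s
    using S[OF that] unfolding T_def by measurable
  have pieces: "emeasure M (T s J) \<le> ennreal \<delta> * emeasure M (Q J)"
    if J: "J \<in> Pow I" and s: "s\<^sup>2 = 1" for J s
    unfolding T_def
  proof (rule subgaussian_upper_tail)
    fix t :: real
    have *: "(\<integral>\<^sup>+\<omega>. ennreal (exp (u * S J \<omega>)) * indicator (Q J) \<omega> \<partial>M) =
      (\<Prod>i\<in>J. \<integral>\<^sup>+\<omega>. ennreal (exp (u * e (D i \<omega>))) * indicator A (D i \<omega>) \<partial>M) *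
         (\<Prod>i\<in>I - J. \<integral>\<^sup>+\<omega>. indicator (- A) (D i \<omega>) \<partial>M)" for u
      unfolding S_def Q_def using J
      by (intro nn_integral_exp_occupancy_pattern[OF I _ indep]) auto
    have "(\<integral>\<^sup>+\<omega>. ennreal (exp ((t * s) * S J \<omega>)) * indicator (Q J) \<omega> \<partial>M)
      \<le> (\<Prod>i\<in>J. ennreal (exp ((t * s)\<^sup>2 * v / 2)) * (\<integral>\<^sup>+\<omega>. indicator A (D i \<omega>) \<partial>M)) *
         (\<Prod>i\<in>I - J. \<integral>\<^sup>+\<omega>. indicator (- A) (D i \<omega>) \<partial>M)"
      unfolding * using J by (intro mult_right_mono prod_mono_ennreal) (auto intro!: mgf)
    \<comment> \<open>What remains of the products is the same formula at \<open>u = 0\<close>, that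
      is, the probability of \<open>Q J\<close>.\<close>
    also have "\<dots> = (\<Prod>i\<in>J. ennreal (exp ((t * s)\<^sup>2 * v / 2))) *
        (\<integral>\<^sup>+\<omega>. ennreal (exp (0 * S J \<omega>)) * indicator (Q J) \<omega> \<partial>M)"
      unfolding * by (simp add: prod.distrib mult.assoc)
    also have "(\<Prod>i\<in>J. ennreal (exp ((t * s)\<^sup>2 * v / 2))) = ennreal (exp (t\<^sup>2 * (real (card J) * v) / 2))"
      by (simp add: ennreal_power exp_of_nat_mult[symmetric] power_mult_distrib s field_simps)
    finally show "(\<integral>\<^sup>+\<omega>. ennreal (exp (t * (s * S J \<omega>))) * indicator (Q J) \<omega> \<partial>M)
        \<le> ennreal (exp (t\<^sup>2 * (real (card J) * v) / 2)) * emeasure M (Q J)"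
      by (simp add: mult.assoc)
  qed (use S[OF J] assms in auto)
  have "?B \<subseteq> (\<Union>J\<in>Pow I. T 1 J \<union> T (- 1) J)"
  proof
    fix \<omega> assume \<omega>: "\<omega> \<in> ?B"
    define J where "J = {i\<in>I. D i \<omega> \<in> A}"
    have J: "J \<in> Pow I" "\<omega> \<in> Q J" using \<omega> by (auto simp: J_def Q_def)
    have "(\<Sum>i\<in>I. indicator A (D i \<omega>)) = real (card J)"
      using I by (simp add: indicator_def J_def sum.If_cases Int_def)
    moreover have "(\<Sum>i\<in>I. e (D i \<omega>) * indicator A (D i \<omega>)) = S J \<omega>"
      using I unfolding S_def J_def by (simp add: sum.inter_filter indicator_def of_bool_def if_distrib cong: if_cong)
    ultimately have "?r J < \<bar>S J \<omega>\<bar>" using \<omega> by (simp add: mult.commute mult.left_commute)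
    then show "\<omega> \<in> (\<Union>J\<in>Pow I. T 1 J \<union> T (- 1) J)"
      using J by (auto simp: T_def abs_real_def split: if_splits)
  qed
  then have "emeasure M ?B \<le> emeasure M (\<Union>J\<in>Pow I. T 1 J \<union> T (- 1) J)"
    using I by (intro emeasure_mono sets.finite_UN) auto
  also have "\<dots> \<le> (\<Sum>J\<in>Pow I. emeasure M (T 1 J \<union> T (- 1) J))"
    using I by (intro emeasure_subadditive_finite) auto
  also have "\<dots> \<le> (\<Sum>J\<in>Pow I. ennreal (2 * \<delta>) * emeasure M (Q J))"
  proof (rule sum_mono)
    fix J assume J: "J \<in> Pow I"
    have "emeasure M (T 1 J \<union> T (- 1) J) \<le> emeasure M (T 1 J) + emeasure M (T (- 1) J)"
      using J by (intro emeasure_subadditive) auto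
    also have "\<dots> \<le> ennreal \<delta> * emeasure M (Q J) + ennreal \<delta> * emeasure M (Q J)"
      using J by (intro add_mono pieces) auto
    also have "\<dots> = ennreal (2 * \<delta>) * emeasure M (Q J)"
      using assms by (simp add: distrib_right[symmetric] ennreal_plus[symmetric] del: ennreal_plus)
    finally show "emeasure M (T 1 J \<union> T (- 1) J) \<le> ennreal (2 * \<delta>) * emeasure M (Q J)" .
  qed
  also have "\<dots> = ennreal (2 * \<delta>) * (\<Sum>J\<in>Pow I. emeasure M (Q J))"
    by (simp add: sum_distrib_left)
  \<comment> \<open>The patterns are disjoint, so their probabilities add up to at most 1: the
    splitting costs nothing although there are exponentially many patterns.\<close>
  also have "(\<Sum>J\<in>Pow I. emeasure M (Q J)) = emeasure M (\<Union>J\<in>Pow I. Q J)"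
    using I by (intro sum_emeasure) (auto simp: disjoint_family_on_def Q_def)
  also have "ennreal (2 * \<delta>) * \<dots> \<le> ennreal (2 * \<delta>) * 1"
    by (intro mult_left_mono measure_le_1) simp
  finally show ?thesis by simp
qed

text \<open>Chernoff's bound with parameter \<open>ln 2\<close>, for which the exponential weight of
  each index becomes 1 minus half its indicator. The mean of this is at most
  \<open>1 - q / 2\<close>, hence at most \<open>exp (- q / 2)\<close>. With
  \<open>n = card I\<close> the exponent is \<open>- (1 - ln 2) * n * q / 2\<close>, and
  \<open>1 - ln 2\<close> exceeds \<open>1 / 4\<close>.\<close>

lemma (in prob_space) count_in_set_lower_tail:
  assumes I: "finite I" and indep: "indep_vars (\<lambda>_. N) D I"
    and [measurable]: "A \<in> sets N"
    and q: "\<And>i. i \<in> I \<Longrightarrow> q \<le> prob {\<omega>\<in>space M. D i \<omega> \<in> A}"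
  shows "emeasure M {\<omega>\<in>space M. (\<Sum>i\<in>I. indicator A (D i \<omega>)) < real (card I) * q / 2}
    \<le> ennreal (exp (- (real (card I) * q / 8)))"
proof (cases "q \<le> 0 \<or> I = {}")
  case True
  have "(\<Sum>i\<in>I. indicator A (D i \<omega>)) \<ge> (0 :: real)" for \<omega> by (intro sum_nonneg) auto
  moreover have "real (card I) * q / 2 \<le> 0" using True by (auto simp: mult_le_0_iff)
  ultimately have "{\<omega>\<in>space M. (\<Sum>i\<in>I. indicator A (D i \<omega>)) < real (card I) * q / 2} = {}"
    by (fastforce dest: order.strict_trans2 simp: not_less intro: order_trans)
  then show ?thesis by (simp only: emeasure_empty zero_le)
next
  case False
  have D[measurable]: "D i \<in> measurable M N" if "i \<in> I" for i
    using indep that by (auto simp: indep_vars_def)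
  have q1: "q \<le> 1" using False q prob_le_1 by (meson ex_in_conv order_trans)
  let ?n = "real (card I)"
  let ?K = "\<lambda>\<omega>. \<Sum>i\<in>I. indicator A (D i \<omega>) :: real"
  have K[measurable]: "?K \<in> borel_measurable M" by (intro borel_measurable_sum) measurable
  have "emeasure M {\<omega>\<in>space M. ?K \<omega> < ?n * q / 2} \<le> emeasure M {\<omega>\<in>space M. ?K \<omega> \<le> ?n * q / 2}"
    by (intro emeasure_mono) auto
  also have "\<dots> \<le> ennreal (exp (ln 2 * (?n * q / 2))) *
      (\<integral>\<^sup>+\<omega>. ennreal (exp (- ln 2 * ?K \<omega>)) * indicator (space M) \<omega> \<partial>M)"
    by (rule Chernoff_ineq_nn_integral_le) auto
  also have "(\<integral>\<^sup>+\<omega>. ennreal (exp (- ln 2 * ?K \<omega>)) * indicator (space M) \<omega> \<partial>M)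
     = (\<integral>\<^sup>+\<omega>. (\<Prod>i\<in>I. ennreal (1 - indicator A (D i \<omega>) / 2)) \<partial>M)"
  proof (intro nn_integral_cong)
    fix \<omega> assume "\<omega> \<in> space M"
    have "exp (- ln 2 * ?K \<omega>) = (\<Prod>i\<in>I. exp (- ln 2 * indicator A (D i \<omega>)))"
      using I by (simp add: exp_sum[symmetric] sum_distrib_left sum_negf)
    also have "\<dots> = (\<Prod>i\<in>I. 1 - indicator A (D i \<omega>) / 2)"
      by (intro prod.cong) (auto simp: exp_minus split: split_indicator)
    finally show "ennreal (exp (- ln 2 * ?K \<omega>)) * indicator (space M) \<omega> =
        (\<Prod>i\<in>I. ennreal (1 - indicator A (D i \<omega>) / 2))"
      using \<open>\<omega> \<in> space M\<close> by (subst prod_ennreal) (auto split: split_indicator)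
  qed
  also have "\<dots> = (\<Prod>i\<in>I. \<integral>\<^sup>+\<omega>. ennreal (1 - indicator A (D i \<omega>) / 2) \<partial>M)"
    using I by (intro indep_vars_nn_integral indep_vars_compose2[OF indep]) auto
  also have "\<dots> \<le> (\<Prod>i\<in>I. ennreal (exp (- q / 2)))"
  proof (intro prod_mono_ennreal)
    fix i assume i: "i \<in> I"
    have "(\<integral>\<^sup>+\<omega>. ennreal (1 - indicator A (D i \<omega>) / 2) \<partial>M)
        = ennreal (\<integral>\<omega>. 1 - indicator A (D i \<omega>) / 2 \<partial>M)"
      using i by (intro nn_integral_eq_integral integrable_const_bound[where B = 1]) (auto split: split_indicator)
    also have "(\<integral>\<omega>. 1 - indicator A (D i \<omega>) / 2 \<partial>M)
        = (\<integral>\<omega>. 1 - indicator {\<omega>\<in>space M. D i \<omega> \<in> A} \<omega> / (2 :: real) \<partial>M)"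
      by (intro Bochner_Integration.integral_cong) (auto split: split_indicator)
    also have "\<dots> = 1 - prob {\<omega>\<in>space M. D i \<omega> \<in> A} / 2"
    proof -
      have "integrable M (indicator {\<omega>\<in>space M. D i \<omega> \<in> A} :: 'a \<Rightarrow> real)"
        using i by (intro integrable_real_indicator) (auto simp: emeasure_eq_measure)
      then show ?thesis
        using i by (subst Bochner_Integration.integral_diff) (simp_all add: prob_space)
    qed
    also have "\<dots> \<le> 1 + (- q / 2)" using q[OF i] by simp
    also have "\<dots> \<le> exp (- q / 2)" by (rule exp_ge_add_one_self)
    finally show "(\<integral>\<^sup>+\<omega>. ennreal (1 - indicator A (D i \<omega>) / 2) \<partial>M) \<le> ennreal (exp (- q / 2))"
      by (simp add: ennreal_leI)
  qed
  also have "ennreal (exp (ln 2 * (?n * q / 2))) * (\<Prod>i\<in>I. ennreal (exp (- q / 2)))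
      = ennreal (exp (ln 2 * (?n * q / 2) - ?n * q / 2))"
    by (simp add: ennreal_power exp_of_nat_mult[symmetric] ennreal_mult[symmetric] exp_add[symmetric])
  also have "\<dots> \<le> ennreal (exp (- (?n * q / 8)))"
  proof -
    have "ln 2 * (?n * q / 2) \<le> 25 / 36 * (?n * q / 2)"
      using ln2_le_25_over_36 False by (intro mult_right_mono) auto
    then have "ln 2 * (?n * q / 2) - ?n * q / 2 \<le> - (?n * q / 8)" using False
      by (simp add: field_simps)
    then show ?thesis by (simp add: ennreal_leI)
  qed
  finally show ?thesis by (simp add: mult_left_mono)
qed

section \<open>Nets, Voronoi cells and local averages\<close>

text \<open>\<open>LEAST\<close> over the reals is meaningful only if the minimum is attained. It
  is: each pair of distinct points bounds the admissible constants below by its difference quotient,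
  and these bounds pass to the infimum.\<close>

lemma lipschitz_on_lip_const:
  fixes g :: "'a::metric_space \<Rightarrow> real"
  assumes "L-lipschitz_on V g"
  shows "(lip_const g V)-lipschitz_on V g"
proof -
  define \<C> where "\<C> = {C. C-lipschitz_on V g}"
  have ne: "L \<in> \<C>" using assms by (simp add: \<C>_def)
  have bdd: "bdd_below \<C>" by (rule bdd_belowI[of _ 0]) (simp add: \<C>_def lipschitz_on_nonneg)
  have Inf: "(Inf \<C>)-lipschitz_on V g"
  proof (rule lipschitz_onI)
    show "0 \<le> Inf \<C>" using ne by (intro cInf_greatest) (auto simp: \<C>_def dest: lipschitz_on_nonneg)
    fix x y assume xy: "x \<in> V" "y \<in> V"
    show "dist (g x) (g y) \<le> Inf \<C> * dist x y"
    proof (cases "x = y")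
      case False
      have "dist (g x) (g y) / dist x y \<le> Inf \<C>"
        using ne xy False by (intro cInf_greatest) (auto simp: \<C>_def lipschitz_on_def field_simps)
      with False show ?thesis by (simp add: field_simps)
    qed simp
  qed
  have "lip_const g V = Inf \<C>"
    unfolding lip_const_def using Inf bdd by (intro Least_equality) (auto simp: \<C>_def intro: cInf_lower)
  with Inf show ?thesis by simp
qed

text \<open>A point farther than \<open>\<eta>\<close> from all of \<open>N\<close> could be added
  to it, against maximality.\<close>

lemma eta_net_dense:
  assumes "eta_net \<eta> A N" and "z \<in> A" and "0 \<le> \<eta>"
  shows "\<exists>p\<in>N. dist z p \<le> \<eta>"
proof (cases "z \<in> N")
  case False
  then have "\<not> separated \<eta> (insert z N)" using assms unfolding eta_net_def by blast
  then show ?thesis using assms unfolding eta_net_def separated_def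
    by (metis dist_commute insert_iff not_le)
next
  case True
  then show ?thesis using \<open>0 \<le> \<eta>\<close> by (intro bexI[of _ z]) auto
qed

lemma nearest_index_minimal:
  fixes y :: "'a::metric_space"
  assumes \<kappa>: "tie_rule \<kappa>" and "ps \<noteq> []"
  defines "k \<equiv> nearest_index \<kappa> ps y"
  shows "k < length ps" and "\<And>p. p \<in> set ps \<Longrightarrow> dist y (ps ! k) \<le> dist y p"
proof -
  let ?T = "{k. k < length ps \<and> (\<forall>l < length ps. dist y (ps ! k) \<le> dist y (ps ! l))}"
  have "\<exists>k\<in>{..<length ps}. \<forall>l\<in>{..<length ps}. dist y (ps ! k) \<le> dist y (ps ! l)"
    using assms ex_min_if_finite[of "(\<lambda>k. dist y (ps ! k)) ` {..<length ps}"]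
    by (fastforce simp: not_less)
  then have "?T \<noteq> {}" by auto
  then have "\<kappa> ?T \<in> ?T" by (intro \<kappa>[unfolded tie_rule_def, THEN spec, THEN mp]) simp
  then have "k \<in> ?T" by (simp only: k_def nearest_index_def)
  then show "k < length ps" and "\<And>p. p \<in> set ps \<Longrightarrow> dist y (ps ! k) \<le> dist y p"
    by (auto simp: in_set_conv_nth)
qed

text \<open>A point within \<open>\<eta> / 2\<close> of the center is at most as far from its own
  nearest net point, so the two net points are within \<open>\<eta>\<close> of each other and
  coincide. The list being distinct, their indices coincide too, whatever the tie rule.\<close>

lemma ball_subset_voronoi_cell:
  assumes \<kappa>: "tie_rule \<kappa>" and ne: "ps \<noteq> []"
    and "distinct ps" and sep: "separated \<eta> (set ps)"
  shows "S \<inter> cball (ps ! nearest_index \<kappa> ps x) (\<eta> / 2) \<subseteq> voronoi_cell \<kappa> S ps x"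
proof
  let ?k = "nearest_index \<kappa> ps x"
  fix y assume y: "y \<in> S \<inter> cball (ps ! ?k) (\<eta> / 2)"
  let ?j = "nearest_index \<kappa> ps y"
  note k = nearest_index_minimal[OF \<kappa> ne, where y = x] and j = nearest_index_minimal[OF \<kappa> ne, where y = y]
  have "dist y (ps ! ?j) \<le> dist y (ps ! ?k)" using j(2) k(1) by simp
  then have "dist (ps ! ?j) (ps ! ?k) \<le> \<eta>"
    using y dist_triangle2[of "ps ! ?j" "ps ! ?k" y] by (auto simp: dist_commute)
  then have "ps ! ?j = ps ! ?k" using sep j(1) k(1) unfolding separated_def by (meson not_le nth_mem)
  then have "?j = ?k" using \<open>distinct ps\<close> j(1) k(1) by (simp add: nth_eq_iff_index_eq)
  then show "y \<in> voronoi_cell \<kappa> S ps x" using y by (simp add: voronoi_cell_def)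
qed

text \<open>Both points lie within \<open>r\<close> of the center that they share.\<close>

lemma dist_voronoi_cell_le:
  assumes \<kappa>: "tie_rule \<kappa>" and ne: "ps \<noteq> []"
    and near: "\<And>y. y \<in> S \<Longrightarrow> \<exists>p\<in>set ps. dist y p \<le> r"
    and x: "x \<in> S" and y: "y \<in> voronoi_cell \<kappa> S ps x"
  shows "dist y x \<le> 2 * r"
proof -
  let ?k = "nearest_index \<kappa> ps x"
  have yk: "nearest_index \<kappa> ps y = ?k" "y \<in> S" using y by (auto simp: voronoi_cell_def)
  have "dist u (ps ! ?k) \<le> r" if "u \<in> {x, y}" for u
    using near[of u] nearest_index_minimal(2)[OF \<kappa> ne, where y = u] that x yk
    by (fastforce intro: order_trans)
  from this[of x] this[of y] show ?thesis
    using dist_triangle2[of y x "ps ! ?k"] by simp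
qed

text \<open>The error splits into averaged noise and a bias. Dividing the noise bound
  \<open>sqrt (w * K)\<close> by the random count \<open>K\<close> gives
  \<open>sqrt (w / K)\<close>, which decreases in \<open>K\<close>, so a lower bound on the count
  suffices; it also keeps the denominator positive.\<close>

lemma local_average_error_le:
  fixes g :: "'a::metric_space \<Rightarrow> real"
  assumes lip: "C-lipschitz_on V g" and x: "x \<in> V"
    and diam: "\<And>y. y \<in> V \<Longrightarrow> dist y x \<le> D"
    and K: "K = (\<Sum>i=1..n. indicator V (xs i))" and "K \<ge> k0" "k0 > 0"
    and "0 \<le> w"
    and noise: "\<bar>\<Sum>i=1..n. (ys i - g (xs i)) * indicator V (xs i)\<bar> \<le> sqrt (w * K)"
  shows "\<bar>local_average n xs ys V - g x\<bar> \<le> sqrt (w / k0) + C * D"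
proof -
  have K0: "K > 0" using assms by simp
  let ?N = "\<Sum>i=1..n. (ys i - g (xs i)) * indicator V (xs i)"
  let ?B = "\<Sum>i=1..n. (g (xs i) - g x) * indicator V (xs i)"
  have "(\<Sum>i=1..n. ys i * indicator V (xs i)) = ?N + ?B + g x * K"
    unfolding K sum_distrib_left sum.distrib[symmetric] by (intro sum.cong refl) (simp add: algebra_simps)
  then have "local_average n xs ys V = (?N + ?B + g x * K) / K"
    by (simp only: local_average_def K)
  then have "local_average n xs ys V - g x = (?N + ?B) / K"
    using K0 by (simp only: add_divide_distrib) simp
  then have "\<bar>local_average n xs ys V - g x\<bar> = \<bar>?N + ?B\<bar> / K" using K0 by simp
  also have "\<dots> \<le> sqrt (w * K) / K + C * D * K / K"
  proof -
    have "\<bar>?B\<bar> \<le> (\<Sum>i=1..n. C * D * indicator V (xs i))"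
    proof (rule order_trans[OF sum_abs], rule sum_mono)
      fix i
      have "\<bar>g (xs i) - g x\<bar> \<le> C * D" if "xs i \<in> V"
      proof -
        have "\<bar>g (xs i) - g x\<bar> \<le> C * dist (xs i) x"
          using lipschitz_onD[OF lip that x] by (simp add: dist_real_def)
        also have "\<dots> \<le> C * D" using diam[OF that] lipschitz_on_nonneg[OF lip] by (intro mult_left_mono)
        finally show ?thesis .
      qed
      then show "\<bar>(g (xs i) - g x) * indicator V (xs i)\<bar> \<le> C * D * indicator V (xs i)"
        by (auto split: split_indicator)
    qed
    then have "\<bar>?B\<bar> \<le> C * D * K" unfolding K by (simp add: sum_distrib_left)
    then have "\<bar>?N + ?B\<bar> \<le> sqrt (w * K) + C * D * K" using noise by linarith
    then have "\<bar>?N + ?B\<bar> / K \<le> (sqrt (w * K) + C * D * K) / K"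
      using K0 by (intro divide_right_mono) auto
    then show ?thesis by (simp add: add_divide_distrib)
  qed
  also have "sqrt (w * K) / K = sqrt (w / K)"
    using K0 by (simp add: real_sqrt_mult real_sqrt_divide field_simps)
  also have "sqrt (w / K) \<le> sqrt (w / k0)"
    using assms K0 by (intro real_sqrt_le_mono divide_left_mono) auto
  finally show ?thesis using K0 by simp
qed

text \<open>A separated subset of largest cardinality exists because the cardinalities are bounded;
  it admits no further point, which makes it \<open>r\<close>-dense.\<close>

lemma finite_centers_of_bounded_packing:
  fixes S :: "'a::metric_space set"
  assumes "\<And>C. finite C \<Longrightarrow> C \<subseteq> S \<Longrightarrow> separated r C \<Longrightarrow> real (card C) \<le> B" and "0 \<le> r"
  obtains C where "finite C" "C \<subseteq> S" "real (card C) \<le> B" "\<And>y. y \<in> S \<Longrightarrow> \<exists>z\<in>C. dist y z \<le> r"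
proof -
  let ?P = "\<lambda>C. finite C \<and> C \<subseteq> S \<and> separated r C"
  have "card C \<le> nat \<lfloor>B\<rfloor>" if "?P C" for C
    using assms(1)[of C] that by (simp add: le_nat_floor)
  moreover have "?P {}" by (simp add: separated_def)
  ultimately obtain C where C: "?P C" and max: "\<And>C'. ?P C' \<Longrightarrow> card C' \<le> card C"
    using ex_has_greatest_nat[of ?P "{}" card "Suc (nat \<lfloor>B\<rfloor>)"] by (auto simp: less_Suc_eq_le)
  have "\<exists>z\<in>C. dist y z \<le> r" if "y \<in> S" for y
  proof (cases "y \<in> C")
    case False
    have "\<not> separated r (insert y C)"
    proof
      assume "separated r (insert y C)"
      then have "card (insert y C) \<le> card C" using C \<open>y \<in> S\<close> by (intro max) simp
      with False C show False by simp
    qed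
    then obtain p q where "p \<in> insert y C" "q \<in> insert y C" "p \<noteq> q" "dist p q \<le> r"
      by (auto simp: separated_def not_less)
    then show ?thesis using C by (auto simp: separated_def dist_commute not_le[symmetric])
  next
    case True
    then show ?thesis using \<open>0 \<le> r\<close> by (intro bexI[of _ y]) auto
  qed
  with C show ?thesis using assms(1)[of C] by (intro that[of C]) auto
qed

text \<open>The selector is specified only on extensional functions, the points of the product
  space, so \<open>w\<close> is first restricted to \<open>{1..m}\<close>. The last claim passes
  from a prototype on to the net at the cost \<open>\<eta>\<close>.\<close>

lemma net_points_properties:
  fixes w :: "nat \<Rightarrow> 'a::euclidean_space"
  assumes "net_selector \<eta> m sel" and m: "1 \<le> m" and "0 < \<eta>"
  defines "ps \<equiv> net_points sel m w"
  shows "ps \<noteq> []" and "distinct ps" and "separated \<eta> (set ps)" and "set ps \<subseteq> w ` {1..m}"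
    and "\<And>j y r. j \<in> {1..m} \<Longrightarrow> dist y (w j) \<le> r \<Longrightarrow> \<exists>p\<in>set ps. dist y p \<le> \<eta> + r"
proof -
  let ?w = "restrict w {1..m}"
  have "?w \<in> space (PiM {1..m} (\<lambda>_. borel))" by (simp add: space_PiM)
  then have distinct: "distinct (map ?w (sel ?w))"
    and net: "eta_net \<eta> (?w ` {1..m}) (set (map ?w (sel ?w)))"
    using assms(1) unfolding net_selector_def by blast+
  have ps: "ps = map ?w (sel ?w)" by (simp add: ps_def net_points_def Let_def)
  have img: "?w ` {1..m} = w ` {1..m}" by simp
  have net: "eta_net \<eta> (w ` {1..m}) (set ps)" using net by (simp only: ps img)
  show "distinct ps" using distinct by (simp only: ps)
  show "separated \<eta> (set ps)" "set ps \<subseteq> w ` {1..m}" using net by (simp_all only: eta_net_def)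
  show dense: "\<exists>p\<in>set ps. dist y p \<le> \<eta> + r" if "j \<in> {1..m}" "dist y (w j) \<le> r" for j y r
  proof -
    have "\<exists>p\<in>set ps. dist (w j) p \<le> \<eta>"
      using eta_net_dense[OF net imageI[of j, OF \<open>j \<in> {1..m}\<close>]] \<open>0 < \<eta>\<close> by simp
    then obtain p where p: "p \<in> set ps" "dist (w j) p \<le> \<eta>" by blast
    then have "dist y p \<le> \<eta> + r" using that dist_triangle[of y p "w j"] by simp
    with p show ?thesis by blast
  qed
  show "ps \<noteq> []" using dense[of 1 "w 1" 0] m by auto
qed

section \<open>Measurability of the random cell\<close>

text \<open>Joint measurability in the point and the prototypes is what allows the prototypes to be
  held fixed later. Once the list of retained indices is fixed, membership depends on finitely many
  comparisons of distances, and there are only countably many lists. The index set \<open>J\<close>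
  may be larger because the prototype family also contains index 0.\<close>

lemma measurable_voronoi_cell_of_prototypes:
  fixes x :: "'a::euclidean_space"
  assumes "net_selector \<eta> m sel" and [measurable]: "S \<in> sets borel"
    and m: "{1..m} \<subseteq> J"
  shows "{(y, w) \<in> space (borel \<Otimes>\<^sub>M PiM J (\<lambda>_. borel)).
            y \<in> voronoi_cell \<kappa> S (net_points sel m w) x} \<in> sets (borel \<Otimes>\<^sub>M PiM J (\<lambda>_. borel))"
proof -
  let ?M = "borel \<Otimes>\<^sub>M PiM J (\<lambda>_. borel) :: ('a \<times> (nat \<Rightarrow> 'a)) measure"
  have [measurable]: "sel \<in> measurable (PiM {1..m} (\<lambda>_. borel)) (count_space UNIV)"
    and sel: "\<And>z. z \<in> space (PiM {1..m} (\<lambda>_. borel)) \<Longrightarrow> set (sel z) \<subseteq> {1..m}"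
    using assms(1) unfolding net_selector_def by auto
  define s where "s w = sel (restrict w {1..m})" for w
  have s: "(\<lambda>yw. s (snd yw)) \<in> measurable ?M (count_space UNIV)"
    unfolding s_def
    by (rule measurable_compose[OF measurable_compose[OF measurable_snd measurable_restrict_subset[OF m]]]) measurable
  have s_sub: "set (s w) \<subseteq> {1..m}" if "w \<in> space (PiM J (\<lambda>_. borel))" for w
    unfolding s_def using that m by (intro sel) (auto simp: space_PiM)
  have near: "(\<lambda>yw. nearest_index \<kappa> (map (snd yw) js) (h yw)) \<in> measurable ?M (count_space UNIV)"
    if js: "set js \<subseteq> {1..m}" and [measurable]: "h \<in> measurable ?M borel" for js and h :: "_ \<Rightarrow> 'a"
  proof -
    have comp: "(\<lambda>yw. snd yw (js ! l)) \<in> measurable ?M borel" if "l < length js" for l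
      using js m that by (intro measurable_compose[OF measurable_snd] measurable_component_singleton)
        (meson nth_mem subsetD)
    have "Measurable.pred ?M (\<lambda>yw. k < length js \<and>
        (\<forall>l\<in>{..<length js}. dist (h yw) (snd yw (js ! k)) \<le> dist (h yw) (snd yw (js ! l))))" for k
    proof (cases "k < length js")
      case True
      note [measurable] = comp[OF True]
      have "Measurable.pred ?M (\<lambda>yw. \<forall>l\<in>{..<length js}.
          dist (h yw) (snd yw (js ! k)) \<le> dist (h yw) (snd yw (js ! l)))"
      proof (intro pred_intros_finite)
        fix l assume "l \<in> {..<length js}"
        then have [measurable]: "(\<lambda>yw. snd yw (js ! l)) \<in> measurable ?M borel" using comp by simp
        show "Measurable.pred ?M (\<lambda>yw. dist (h yw) (snd yw (js ! k)) \<le> dist (h yw) (snd yw (js ! l)))"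
          by measurable
      qed simp
      with True show ?thesis by simp
    qed simp
    note T_pred = this
    \<comment> \<open>The set of tied indices ranges over a finite collection, so composing it with
      an arbitrary \<open>\<kappa>\<close> preserves measurability.\<close>
    define T where "T yw = {k\<in>{..<length js}. \<forall>l\<in>{..<length js}.
        dist (h yw) (snd yw (js ! k)) \<le> dist (h yw) (snd yw (js ! l))}" for yw
    have "T \<in> measurable ?M (count_space (Pow {..<length js}))"
    proof (rule measurable_count_space_eq2[THEN iffD2], simp, intro conjI ballI)
      show "T \<in> space ?M \<rightarrow> Pow {..<length js}" by (auto simp: T_def)
      fix A assume A: "A \<in> Pow {..<length js}"
      have "Measurable.pred ?M (\<lambda>yw. \<forall>k\<in>{..<length js}. k \<in> T yw \<longleftrightarrow> k \<in> A)"
      proof (intro pred_intros_finite)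
        fix k
        have k: "Measurable.pred ?M (\<lambda>yw. k \<in> T yw)"
          using T_pred[of k] by (simp only: T_def mem_Collect_eq lessThan_iff)
        show "Measurable.pred ?M (\<lambda>yw. k \<in> T yw \<longleftrightarrow> k \<in> A)"
          using k pred_intros_logic(2)[OF k] by (cases "k \<in> A") simp_all
      qed simp
      also have "(\<lambda>yw. \<forall>k\<in>{..<length js}. k \<in> T yw \<longleftrightarrow> k \<in> A) = (\<lambda>yw. T yw = A)"
        using A by (auto simp: T_def fun_eq_iff)
      finally show "T -` {A} \<inter> space ?M \<in> sets ?M"
        by (simp add: pred_def vimage_def Int_def conj_commute)
    qed
    then have "(\<lambda>yw. \<kappa> (T yw)) \<in> measurable ?M (count_space UNIV)"
      by (rule measurable_compose) simp
    also have "(\<lambda>yw. \<kappa> (T yw)) = (\<lambda>yw. nearest_index \<kappa> (map (snd yw) js) (h yw))"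
      unfolding nearest_index_def T_def fun_eq_iff
      by (intro allI arg_cong[where f = \<kappa>]) auto
    finally show ?thesis .
  qed
  \<comment> \<open>Naming the value \<open>js\<close> of the selector turns the event into a
    countable union.\<close>
  have "Measurable.pred ?M (\<lambda>yw. \<exists>js. (s (snd yw) = js \<and> set js \<subseteq> {1..m}) \<and> fst yw \<in> S \<and>
      nearest_index \<kappa> (map (snd yw) js) (fst yw) = nearest_index \<kappa> (map (snd yw) js) x)"
  proof (intro pred_intros_countable)
    fix js
    show "Measurable.pred ?M (\<lambda>yw. (s (snd yw) = js \<and> set js \<subseteq> {1..m}) \<and> fst yw \<in> S \<and>
      nearest_index \<kappa> (map (snd yw) js) (fst yw) = nearest_index \<kappa> (map (snd yw) js) x)"
    proof (cases "set js \<subseteq> {1..m}")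
      case True
      have "Measurable.pred ?M (\<lambda>yw. s (snd yw) = js)"
        using s by measurable
      moreover have "Measurable.pred ?M (\<lambda>yw. fst yw \<in> S)" by measurable
      moreover have "Measurable.pred ?M (\<lambda>yw. nearest_index \<kappa> (map (snd yw) js) (fst yw)
          = nearest_index \<kappa> (map (snd yw) js) x)"
      proof -
        \<comment> \<open>Equality of two random indices is split over their common value.\<close>
        have "Measurable.pred ?M (\<lambda>yw. \<exists>k. nearest_index \<kappa> (map (snd yw) js) x = k \<and>
            nearest_index \<kappa> (map (snd yw) js) (fst yw) = k)"
          using near[OF True, of fst] near[OF True, of "\<lambda>_. x"]
          by (intro pred_intros_countable pred_intros_logic pred_count_space_const1) simp_all
        then show ?thesis by simp
      qed
      ultimately show ?thesis using True by (intro pred_intros_logic) simp_all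
    qed simp
  qed
  then have "{yw \<in> space ?M. \<exists>js. (s (snd yw) = js \<and> set js \<subseteq> {1..m}) \<and> fst yw \<in> S \<and>
      nearest_index \<kappa> (map (snd yw) js) (fst yw) = nearest_index \<kappa> (map (snd yw) js) x} \<in> sets ?M"
    (is "?E \<in> _") by (simp add: pred_def)
  moreover have "?E = {(y, w) \<in> space ?M. y \<in> voronoi_cell \<kappa> S (net_points sel m w) x}"
  proof -
    have net: "net_points sel m w = map w (s w)" if "w \<in> space (PiM J (\<lambda>_. borel))" for w :: "nat \<Rightarrow> 'a"
      using s_sub[OF that] by (auto simp: net_points_def Let_def s_def intro!: map_cong)
    have "p \<in> ?E \<longleftrightarrow> p \<in> {(y, w) \<in> space ?M. y \<in> voronoi_cell \<kappa> S (net_points sel m w) x}" for p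
    proof (cases "p \<in> space ?M")
      case True
      then have w: "snd p \<in> space (PiM J (\<lambda>_. borel))" by (auto simp: space_pair_measure)
      show ?thesis
        using True s_sub[OF w] by (simp add: case_prod_unfold voronoi_cell_def net[OF w])
    qed (simp add: case_prod_unfold)
    then show ?thesis by blast
  qed
  ultimately show ?thesis by simp
qed

section \<open>Covering by the prototypes and independence\<close>

lemma (in prob_space) distributed_lower_bound:
  assumes X: "distributed M lborel X (\<lambda>x. ennreal (f x) * indicator S x)"
    and b: "\<And>x. x \<in> S \<Longrightarrow> b \<le> f x" and A: "A \<in> sets borel" "A \<subseteq> S"
  shows "ennreal b * emeasure lborel A \<le> emeasure M {\<omega>\<in>space M. X \<omega> \<in> A}"
proof -
  have "ennreal b * emeasure lborel A = (\<integral>\<^sup>+x. ennreal b * indicator A x \<partial>lborel)"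
    using A by (subst nn_integral_cmult_indicator) auto
  also have "\<dots> \<le> (\<integral>\<^sup>+x. ennreal (f x) * indicator S x * indicator A x \<partial>lborel)"
    using A b by (intro nn_integral_mono) (auto intro!: ennreal_leI split: split_indicator)
  also have "\<dots> = emeasure M (X -` A \<inter> space M)"
    using A by (intro distributed_emeasure[OF X, symmetric]) simp
  finally show ?thesis by (simp add: vimage_def Int_def conj_commute)
qed

text \<open>Balls of radius \<open>r / 2\<close> around \<open>r\<close>-separated points are
  disjoint, so their masses add up to at most 1.\<close>

lemma (in prob_space) packing_card_bound:
  fixes Z :: "'a \<Rightarrow> 'b::euclidean_space"
  assumes [measurable]: "Z \<in> borel_measurable M"
    and "finite C" and sep: "separated r C" and "0 < r"
    and mass: "\<And>z. z \<in> C \<Longrightarrow> k \<le> prob {\<omega>\<in>space M. Z \<omega> \<in> cball z (r / 2)}"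
  shows "real (card C) * k \<le> 1"
proof -
  have "disjoint_family_on (\<lambda>z. {\<omega>\<in>space M. Z \<omega> \<in> cball z (r / 2)}) C"
  proof (unfold disjoint_family_on_def, intro ballI impI)
    fix z z' assume "z \<in> C" "z' \<in> C" "z \<noteq> z'"
    then have "dist z z' > r" using sep by (simp add: separated_def)
    then show "{\<omega>\<in>space M. Z \<omega> \<in> cball z (r / 2)} \<inter> {\<omega>\<in>space M. Z \<omega> \<in> cball z' (r / 2)} = {}"
    proof (intro equals0I)
      fix \<omega> assume "\<omega> \<in> {\<omega>\<in>space M. Z \<omega> \<in> cball z (r / 2)} \<inter> {\<omega>\<in>space M. Z \<omega> \<in> cball z' (r / 2)}"
      then have "dist z (Z \<omega>) \<le> r / 2" "dist z' (Z \<omega>) \<le> r / 2" by simp_all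
      then show False using dist_triangle2[of z z' "Z \<omega>"] \<open>dist z z' > r\<close> by linarith
    qed
  qed
  then have "(\<Sum>z\<in>C. prob {\<omega>\<in>space M. Z \<omega> \<in> cball z (r / 2)})
      = prob (\<Union>z\<in>C. {\<omega>\<in>space M. Z \<omega> \<in> cball z (r / 2)})"
    using \<open>finite C\<close> by (intro finite_measure_finite_Union[symmetric]) auto
  moreover have "real (card C) * k \<le> (\<Sum>z\<in>C. prob {\<omega>\<in>space M. Z \<omega> \<in> cball z (r / 2)})"
    using mass by (intro sum_bounded_below) auto
  ultimately show ?thesis
    using prob_le_1[of "\<Union>z\<in>C. {\<omega>\<in>space M. Z \<omega> \<in> cball z (r / 2)}"] by linarith
qed

text \<open>The arithmetic of the union bound, with \<open>l = ln (12 * real m / \<delta>)\<close>: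
  the first factor bounds the number of centers, the second the probability of missing a given one.
  Since \<open>4 * d \<le> m\<close>, the number is at most \<open>m ^ (d + 1)\<close>, hence at
  most \<open>m ^ (2 * d)\<close>; the probability is at most \<open>exp (- l) ^ (2 * d)\<close>,
  where \<open>exp (- l) = \<delta> / (12 * m)\<close> cancels the power of
  \<open>m\<close>.\<close>

lemma covering_number_times_miss_probability_le:
  fixes d m :: nat and \<delta> :: real
  assumes d: "1 \<le> d" and \<delta>: "0 < \<delta>" "\<delta> < 1 / 4" and m: "1 \<le> m"
    and large: "32 * real d * ln (12 * real m / \<delta>) \<le> real m"
  shows "(4 * real d) ^ d * real m / (32 * real d * ln (12 * real m / \<delta>)) *
           exp (- (16 * real d * ln (12 * real m / \<delta>))) \<le> \<delta>"
proof -
  define l where "l = ln (12 * real m / \<delta>)"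
  have "3 \<le> 12 * real m / \<delta>" using \<delta> m by (simp add: field_simps)
  then have "exp 1 \<le> 12 * real m / \<delta>" using exp_le by linarith
  then have l: "1 \<le> l" using \<delta> m by (simp add: l_def ln_ge_iff)
  have "1 * 1 \<le> real d * l" using d l by (intro mult_mono) auto
  then have dl: "1 \<le> real d * l" by simp
  have "real d * 1 \<le> real d * l" using l by (intro mult_left_mono) auto
  then have "real d \<le> real d * l" by (simp only: mult_1_right)
  moreover have "32 * (real d * l) \<le> real m" using large by (simp add: l_def mult.assoc)
  ultimately have "4 * real d \<le> real m" using of_nat_0_le_iff[of d] by linarith
  then have "(4 * real d) ^ d \<le> real m ^ d" by (intro power_mono) auto
  moreover have "1 \<le> 32 * real d * l" using dl by (simp add: mult.assoc)
  ultimately have 1: "(4 * real d) ^ d * real m / (32 * real d * l) \<le> real m ^ d * real m / 1"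
    by (intro frac_le mult_right_mono) auto
  also have "\<dots> = real m ^ Suc d" by simp
  also have "\<dots> \<le> real m ^ (2 * d)" using m d by (intro power_increasing) auto
  finally have B: "(4 * real d) ^ d * real m / (32 * real d * l) \<le> real m ^ (2 * d)" .
  have "- (16 * real d * l) \<le> real (2 * d) * - l"
  proof -
    have "real (2 * d) * - l = - (2 * (real d * l))" by simp
    then show ?thesis using dl by linarith
  qed
  then have "exp (- (16 * real d * l)) \<le> exp (real (2 * d) * - l)" by simp
  also have "\<dots> = exp (- l) ^ (2 * d)" by (rule exp_of_nat_mult)
  also have "exp (- l) = \<delta> / (12 * real m)" using \<delta> m by (simp add: l_def exp_minus)
  finally have E: "exp (- (16 * real d * l)) \<le> (\<delta> / (12 * real m)) ^ (2 * d)" .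
  have "(4 * real d) ^ d * real m / (32 * real d * l) * exp (- (16 * real d * l))
      \<le> real m ^ (2 * d) * (\<delta> / (12 * real m)) ^ (2 * d)"
    by (rule mult_mono[OF B E]) simp_all
  also have "\<dots> = (\<delta> / 12) ^ (2 * d)"
    using m by (simp add: power_mult_distrib[symmetric])
  also have "\<dots> \<le> (\<delta> / 12) ^ 1" using \<delta> d by (intro power_decreasing) auto
  also have "\<dots> \<le> \<delta>" using \<delta> by simp
  finally show ?thesis by (simp only: l_def)
qed

text \<open>The centers of the covering are chosen \<open>\<tau> / (2 d)\<close>-dense rather than \<open>\<tau> / 2\<close>-dense: a sample
  point within \<open>\<tau> - \<tau> / (2 d)\<close> of every center is then enough, and by Bernoulli's inequality
  the balls of that radius keep at least half of the mass bound of a ball of radius \<open>\<tau>\<close>.\<close>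

lemma (in prob_space) sample_dense_in_support:
  fixes Z :: "nat \<Rightarrow> 'a \<Rightarrow> 'b::euclidean_space"
  assumes indep: "indep_vars (\<lambda>_. borel) Z {1..m}" and m: "1 \<le> m" and d: "1 \<le> d"
    and \<delta>: "0 < \<delta>" "\<delta> < 1 / 4" and k: "0 < k" and T0: "0 < T0" and S: "S \<noteq> {}"
    and mass: "\<And>j z r. j \<in> {1..m} \<Longrightarrow> z \<in> S \<Longrightarrow> 0 < r \<Longrightarrow> r \<le> T0 \<Longrightarrow>
        k * r ^ d \<le> prob {\<omega>\<in>space M. Z j \<omega> \<in> cball z r}"
    and large: "32 * real d * ln (12 * real m / \<delta>) \<le> T0 ^ d * real m * k"
  defines "\<tau> \<equiv> root d (32 * real d * ln (12 * real m / \<delta>) / (real m * k))"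
  shows "\<exists>E\<in>events. emeasure M (space M - E) \<le> ennreal \<delta> \<and>
           (\<forall>\<omega>\<in>E. \<forall>y\<in>S. \<exists>j\<in>{1..m}. dist y (Z j \<omega>) \<le> \<tau>)"
proof -
  define K where "K = 32 * real d * ln (12 * real m / \<delta>)"
  have [measurable]: "Z j \<in> borel_measurable M" if "j \<in> {1..m}" for j
    using indep that by (auto simp: indep_vars_def)
  have "1 < 12 * real m / \<delta>" using \<delta> m by (simp add: field_simps)
  then have "K > 0" using d by (simp add: K_def)
  have \<tau>0: "\<tau> > 0" unfolding \<tau>_def K_def[symmetric] using d \<open>K > 0\<close> k m by simp
  have \<tau>d: "\<tau> ^ d = K / (real m * k)"
    unfolding \<tau>_def K_def[symmetric] using d \<open>K > 0\<close> k m by (intro real_root_pow_pos2) auto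
  have "\<tau> ^ d \<le> T0 ^ d" using large[folded K_def] k m by (simp add: \<tau>d field_simps)
  then have \<tau>T: "\<tau> \<le> T0" using \<tau>0 T0 d by (simp add: power_mono_iff)
  obtain s where "s \<in> S" using S by blast
  \<comment> \<open>The mass bound at radius \<open>T0\<close> cannot exceed 1; together with
    \<open>large\<close> this gives \<open>K \<le> m\<close>.\<close>
  have "k * T0 ^ d \<le> 1" using mass[of 1 s T0] \<open>s \<in> S\<close> T0 m prob_le_1 by (meson atLeastAtMost_iff order.refl order_trans)
  then have "real m * (k * T0 ^ d) \<le> real m * 1" by (intro mult_left_mono) auto
  then have Km: "K \<le> real m" using large[folded K_def] by (simp add: mult.commute mult.left_commute)
  define r where "r = \<tau> / (2 * real d)"
  have r0: "r > 0" using \<tau>0 d by (simp add: r_def)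
  have r\<tau>: "r \<le> \<tau> / 2" using \<tau>0 d by (simp add: r_def field_simps)
  \<comment> \<open>\<open>N\<close> is the reciprocal of the mass bound
    \<open>k * (r / 2) ^ d\<close>, so the packing bound limits the number of centers to
    \<open>N\<close>.\<close>
  define N where "N = (4 * real d) ^ d * real m / K"
  have kr: "k * (r / 2) ^ d = 1 / N"
    unfolding r_def N_def using \<tau>d k m d \<open>K > 0\<close>
    by (simp add: power_divide power_mult_distrib field_simps)
  have N0: "N > 0" using d m \<open>K > 0\<close> by (simp add: N_def)
  obtain C where C: "finite C" "C \<subseteq> S" "real (card C) \<le> N" and cov: "\<And>y. y \<in> S \<Longrightarrow> \<exists>z\<in>C. dist y z \<le> r"
  proof (rule finite_centers_of_bounded_packing[of S r N])
    fix C assume C: "finite C" "C \<subseteq> S" "separated r C"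
    have "real (card C) * (k * (r / 2) ^ d) \<le> 1"
    proof (rule packing_card_bound[of "Z 1" C r])
      fix z assume "z \<in> C"
      then show "k * (r / 2) ^ d \<le> prob {\<omega>\<in>space M. Z 1 \<omega> \<in> cball z (r / 2)}"
        using C r0 r\<tau> \<tau>T \<tau>0 m by (intro mass) auto
    qed (use C r0 m in auto)
    then have "real (card C) * (1 / N) \<le> 1" by (simp only: kr)
    then show "real (card C) \<le> N" using N0 by (simp add: field_simps)
  qed (use r0 in auto)
  define \<rho> where "\<rho> = \<tau> - r"
  have \<rho>: "0 < \<rho>" "\<rho> \<le> T0" using r\<tau> r0 \<tau>T \<tau>0 by (auto simp: \<rho>_def)
  have "1 / 2 \<le> (1 - 1 / (2 * real d)) ^ d"
    using Bernoulli_inequality[of "- (1 / (2 * real d))" d] d by (simp add: field_simps)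
  then have "1 / 2 * \<tau> ^ d \<le> (1 - 1 / (2 * real d)) ^ d * \<tau> ^ d"
    using \<tau>0 by (intro mult_right_mono) auto
  also have "\<dots> = \<rho> ^ d" by (simp add: \<rho>_def r_def power_mult_distrib[symmetric] algebra_simps)
  finally have "k * (\<tau> ^ d / 2) \<le> k * \<rho> ^ d" using k by (intro mult_left_mono) auto
  \<comment> \<open>In terms of \<open>K\<close>, a ball of radius \<open>\<rho>\<close> around a
    center has mass at least \<open>K / (2 * m)\<close>, so that \<open>m\<close> independent points
    all miss it with probability at most \<open>exp (- (K / 2))\<close>.\<close>
  moreover have "k * (\<tau> ^ d / 2) = K / 2 / real m" using k m by (simp add: \<tau>d field_simps)
  ultimately have k\<rho>: "K / 2 / real m \<le> k * \<rho> ^ d" by simp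
  define F where "F z = (\<Inter>j\<in>{1..m}. Z j -` (- cball z \<rho>) \<inter> space M)" for z
  have F[measurable]: "F z \<in> events" for z
    unfolding F_def using m by (intro sets.finite_INT) (auto intro!: measurable_sets)
  have F_le: "prob (F z) \<le> exp (- (K / 2))" if "z \<in> C" for z
  proof -
    have "prob (F z) = (\<Prod>j\<in>{1..m}. prob (Z j -` (- cball z \<rho>) \<inter> space M))"
      unfolding F_def using m by (intro indep_varsD_finite[OF indep]) auto
    also have "\<dots> \<le> (\<Prod>j\<in>{1..m}. exp (- (K / 2 / real m)))"
    proof (intro prod_mono conjI)
      fix j assume j: "j \<in> {1..m}"
      have "Z j -` (- cball z \<rho>) \<inter> space M = space M - {\<omega>\<in>space M. Z j \<omega> \<in> cball z \<rho>}"
        by auto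
      then have "prob (Z j -` (- cball z \<rho>) \<inter> space M) = 1 - prob {\<omega>\<in>space M. Z j \<omega> \<in> cball z \<rho>}"
        using j by (simp add: prob_compl)
      also have "\<dots> \<le> 1 + - (K / 2 / real m)"
        using mass[OF j, of z \<rho>] that C \<rho> k\<rho> by auto
      also have "\<dots> \<le> exp (- (K / 2 / real m))" by (rule exp_ge_add_one_self)
      finally show "prob (Z j -` (- cball z \<rho>) \<inter> space M) \<le> exp (- (K / 2 / real m))" .
    qed simp
    also have "\<dots> = exp (- (K / 2))" using m by (simp add: exp_of_nat_mult[symmetric])
    finally show ?thesis .
  qed
  define E where "E = space M - (\<Union>z\<in>C. F z)"
  have [measurable]: "E \<in> events" unfolding E_def using C by (intro sets.Diff sets.finite_UN) auto
  have "space M - E = (\<Union>z\<in>C. F z)" using sets.sets_into_space[OF F] by (auto simp: E_def)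
  then have "prob (space M - E) \<le> (\<Sum>z\<in>C. prob (F z))"
    using C by (simp only:) (intro finite_measure_subadditive_finite, auto)
  also have "\<dots> \<le> real (card C) * exp (- (K / 2))"
    using F_le by (rule sum_bounded_above)
  also have "\<dots> \<le> N * exp (- (K / 2))" using C by (intro mult_right_mono) auto
  also have "\<dots> \<le> \<delta>"
    using covering_number_times_miss_probability_le[OF d \<delta> m] Km
    by (simp add: N_def K_def mult.assoc)
  finally have "emeasure M (space M - E) \<le> ennreal \<delta>"
    by (simp add: emeasure_eq_measure ennreal_leI)
  moreover have "\<exists>j\<in>{1..m}. dist y (Z j \<omega>) \<le> \<tau>" if "\<omega> \<in> E" "y \<in> S" for \<omega> y
  proof -
    obtain z where z: "z \<in> C" "dist y z \<le> r" using cov \<open>y \<in> S\<close> by blast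
    then have "\<omega> \<notin> F z" "\<omega> \<in> space M" using \<open>\<omega> \<in> E\<close> by (auto simp: E_def)
    then obtain j where j: "j \<in> {1..m}" "Z j \<omega> \<in> cball z \<rho>" unfolding F_def by blast
    then have "dist y (Z j \<omega>) \<le> \<tau>"
      using z dist_triangle[of y "Z j \<omega>" z] by (simp add: \<rho>_def)
    with j show ?thesis by blast
  qed
  ultimately show ?thesis using \<open>E \<in> events\<close> by blast
qed

section \<open>Independence as a product of laws\<close>

text \<open>Rectangles determine a product of sigma-finite measures, and on rectangles the claim is
  the independence of the generated sigma-algebras.\<close>

lemma (in prob_space) distr_pair_of_indep_set:
  assumes indep: "indep_set (sets (vimage_algebra (space M) U N)) (sets (vimage_algebra (space M) W K))"
    and [measurable]: "U \<in> measurable M N" "W \<in> measurable M K"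
  shows "distr M (N \<Otimes>\<^sub>M K) (\<lambda>\<omega>. (U \<omega>, W \<omega>)) = distr M N U \<Otimes>\<^sub>M distr M K W"
proof (rule sym, rule pair_measure_eqI)
  interpret U: prob_space "distr M N U" by (rule prob_space_distr) fact
  interpret W: prob_space "distr M K W" by (rule prob_space_distr) fact
  show "sigma_finite_measure (distr M N U)" "sigma_finite_measure (distr M K W)" by unfold_locales
  show "sets (distr M N U \<Otimes>\<^sub>M distr M K W) = sets (distr M (N \<Otimes>\<^sub>M K) (\<lambda>\<omega>. (U \<omega>, W \<omega>)))"
    by (simp cong: sets_pair_measure_cong)
  fix A B assume A: "A \<in> sets (distr M N U)" and B: "B \<in> sets (distr M K W)"
  then have [measurable]: "A \<in> sets N" "B \<in> sets K" by auto
  have "prob ((U -` A \<inter> space M) \<inter> (W -` B \<inter> space M)) = prob (U -` A \<inter> space M) * prob (W -` B \<inter> space M)"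
    by (rule indep_setD[OF indep]) (auto intro: in_vimage_algebra)
  moreover have "(\<lambda>\<omega>. (U \<omega>, W \<omega>)) -` (A \<times> B) \<inter> space M = (U -` A \<inter> space M) \<inter> (W -` B \<inter> space M)"
    by auto
  ultimately show "emeasure (distr M N U) A * emeasure (distr M K W) B
      = emeasure (distr M (N \<Otimes>\<^sub>M K) (\<lambda>\<omega>. (U \<omega>, W \<omega>))) (A \<times> B)"
    by (simp add: emeasure_distr emeasure_eq_measure ennreal_mult)
qed

text \<open>This takes the place of conditioning on \<open>W\<close>: by Tonelli's theorem the
  probability is the integral, over the law of \<open>W\<close>, of the measures of the sections of
  \<open>B\<close>, and a bound valid for almost every fixed value of \<open>W\<close> integrates to
  itself.\<close>

lemma (in prob_space) emeasure_le_of_sections_le: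
  assumes indep: "indep_set (sets (vimage_algebra (space M) U N)) (sets (vimage_algebra (space M) W K))"
    and [measurable]: "U \<in> measurable M N" "W \<in> measurable M K" "B \<in> sets (N \<Otimes>\<^sub>M K)"
    and le: "AE \<omega> in M. emeasure M {\<omega>'\<in>space M. (U \<omega>', W \<omega>) \<in> B} \<le> a"
  shows "emeasure M {\<omega>\<in>space M. (U \<omega>, W \<omega>) \<in> B} \<le> a"
proof -
  interpret U: prob_space "distr M N U" by (rule prob_space_distr) fact
  interpret W: prob_space "distr M K W" by (rule prob_space_distr) fact
  interpret UW: pair_sigma_finite "distr M N U" "distr M K W" by unfold_locales
  have B: "B \<in> sets (distr M N U \<Otimes>\<^sub>M distr M K W)" by (simp cong: sets_pair_measure_cong)
  have sec: "emeasure (distr M N U) ((\<lambda>u. (u, w)) -` B) = emeasure M {\<omega>\<in>space M. (U \<omega>, w) \<in> B}"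
    if "w \<in> space K" for w
  proof -
    have "(\<lambda>u. (u, w)) -` B \<in> sets N" by (rule sets_Pair2) fact
    then show ?thesis by (subst emeasure_distr) (auto intro!: arg_cong2[where f = emeasure])
  qed
  have "emeasure M {\<omega>\<in>space M. (U \<omega>, W \<omega>) \<in> B}
      = emeasure (distr M (N \<Otimes>\<^sub>M K) (\<lambda>\<omega>. (U \<omega>, W \<omega>))) B"
    by (subst emeasure_distr) (auto intro!: arg_cong2[where f = emeasure])
  also have "\<dots> = emeasure (distr M N U \<Otimes>\<^sub>M distr M K W) B"
    by (simp add: distr_pair_of_indep_set[OF indep])
  also have "\<dots> = (\<integral>\<^sup>+w. emeasure (distr M N U) ((\<lambda>u. (u, w)) -` B) \<partial>distr M K W)"
    by (rule UW.emeasure_pair_measure_alt2[OF B])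
  also have "\<dots> = (\<integral>\<^sup>+\<omega>. emeasure (distr M N U) ((\<lambda>u. (u, W \<omega>)) -` B) \<partial>M)"
    using UW.measurable_emeasure_Pair2[OF B] by (subst nn_integral_distr) auto
  also have "\<dots> = (\<integral>\<^sup>+\<omega>. emeasure M {\<omega>'\<in>space M. (U \<omega>', W \<omega>) \<in> B} \<partial>M)"
    by (intro nn_integral_cong sec measurable_space[OF \<open>W \<in> measurable M K\<close>])
  also have "\<dots> \<le> (\<integral>\<^sup>+\<omega>. a \<partial>M)" by (rule nn_integral_mono_AE[OF le])
  also have "\<dots> = a" by (simp add: emeasure_space_1)
  finally show ?thesis .
qed

section \<open>Conditional bounds given the prototypes\<close>

text \<open>Conditional expectation is eliminated by testing the bound against the indicator of an
  event generated by \<open>W\<close>. The result is an inequality between plain integrals, which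
  can be transferred to copies with the same law.\<close>

lemma (in prob_space) subgaussian_given_mgf_on:
  fixes W :: "'a \<Rightarrow> 'b::topological_space"
  assumes sub: "subgaussian_given M (sigma_gen M W) v \<epsilon>"
    and W[measurable]: "W \<in> borel_measurable M" and A[measurable]: "A \<in> sets borel"
  shows "(\<integral>\<^sup>+\<omega>. ennreal (exp (t * \<epsilon> \<omega>)) * indicator A (W \<omega>) \<partial>M)
      \<le> ennreal (exp (t\<^sup>2 * v / 2)) * (\<integral>\<^sup>+\<omega>. indicator A (W \<omega>) \<partial>M)"
proof -
  let ?F = "sigma_gen M W"
  have [measurable]: "\<epsilon> \<in> borel_measurable M"
    using sub by (auto simp: subgaussian_given_def)
  have "subalgebra M ?F"
    unfolding subalgebra_def using W by (auto simp: space_vimage_algebra dest: subsetD[OF sets_image_in_sets[OF refl W]])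
  then interpret finite_measure_subalgebra M ?F by unfold_locales
  have "W \<in> measurable ?F borel" by (rule measurable_vimage_algebra1) simp
  then have ind: "(\<lambda>\<omega>. indicator A (W \<omega>) :: ennreal) \<in> borel_measurable ?F"
    by (rule measurable_compose) simp
  have "(\<integral>\<^sup>+\<omega>. ennreal (exp (t * \<epsilon> \<omega>)) * indicator A (W \<omega>) \<partial>M)
      = (\<integral>\<^sup>+\<omega>. indicator A (W \<omega>) * nn_cond_exp M ?F (\<lambda>\<omega>'. ennreal (exp (t * \<epsilon> \<omega>'))) \<omega> \<partial>M)"
    by (subst nn_cond_exp_intg[OF ind]) (simp_all add: mult.commute)
  also have "\<dots> \<le> (\<integral>\<^sup>+\<omega>. indicator A (W \<omega>) * ennreal (exp (t\<^sup>2 * v / 2)) \<partial>M)"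
  proof (rule nn_integral_mono_AE)
    have "AE \<omega> in M. nn_cond_exp M ?F (\<lambda>\<omega>'. ennreal (exp (t * \<epsilon> \<omega>'))) \<omega> \<le> ennreal (exp (t\<^sup>2 * v / 2))"
      using sub unfolding subgaussian_given_def by blast
    then show "AE \<omega> in M. indicator A (W \<omega>) * nn_cond_exp M ?F (\<lambda>\<omega>'. ennreal (exp (t * \<epsilon> \<omega>'))) \<omega>
        \<le> indicator A (W \<omega>) * ennreal (exp (t\<^sup>2 * v / 2))"
      by eventually_elim (intro mult_left_mono, simp_all)
  qed
  also have "\<dots> = (\<integral>\<^sup>+\<omega>. indicator A (W \<omega>) \<partial>M) * ennreal (exp (t\<^sup>2 * v / 2))"
    by (rule nn_integral_multc) measurable
  finally show ?thesis by (simp add: mult.commute)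
qed

lemma nn_integral_identically_distributed:
  assumes "distr M N D = distr M N D'" and "D \<in> measurable M N" "D' \<in> measurable M N"
    and "h \<in> borel_measurable N"
  shows "(\<integral>\<^sup>+\<omega>. h (D \<omega>) \<partial>M) = (\<integral>\<^sup>+\<omega>. h (D' \<omega>) \<partial>M)"
proof -
  have "(\<integral>\<^sup>+\<omega>. h (D \<omega>) \<partial>M) = (\<integral>\<^sup>+z. h z \<partial>distr M N D)"
    using assms by (subst nn_integral_distr) auto
  also have "\<dots> = (\<integral>\<^sup>+\<omega>. h (D' \<omega>) \<partial>M)"
    unfolding assms(1) using assms by (subst nn_integral_distr) auto
  finally show ?thesis .
qed

lemma prob_identically_distributed:
  assumes "distr M N D = distr M N D'" and "D \<in> measurable M N" "D' \<in> measurable M N"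
    and "A \<in> sets N"
  shows "measure M {\<omega>\<in>space M. D \<omega> \<in> A} = measure M {\<omega>\<in>space M. D' \<omega> \<in> A}"
proof -
  have *: "{\<omega>\<in>space M. f \<omega> \<in> A} = f -` A \<inter> space M" for f by auto
  show ?thesis unfolding *
    by (simp only: measure_distr[OF assms(2,4), symmetric] measure_distr[OF assms(3,4), symmetric] assms(1))
qed

text \<open>\<open>g\<close> is controlled on \<open>S\<close> only; its extension by 0 is
  measurable because \<open>g\<close> is continuous on the Borel set \<open>S\<close>.\<close>

lemma borel_measurable_if_lipschitz_on:
  fixes g :: "'a::euclidean_space \<Rightarrow> real"
  assumes "L-lipschitz_on S g" and "S \<in> sets borel"
  shows "(\<lambda>x. if x \<in> S then g x else 0) \<in> borel_measurable borel"
proof -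
  have "(\<lambda>x. indicator S x *\<^sub>R g x) \<in> borel_measurable borel"
    using assms by (intro borel_measurable_continuous_on_indicator lipschitz_on_continuous_on)
  also have "(\<lambda>x. indicator S x *\<^sub>R g x) = (\<lambda>x. if x \<in> S then g x else 0)"
    by (auto split: split_indicator)
  finally show ?thesis .
qed

text \<open>The density is at least \<open>b\<close> on \<open>S\<close>, the regularity of
  \<open>S\<close> keeps a fraction \<open>c\<close> of the ball, and the volume of the ball scales
  like \<open>r ^ DIM('b)\<close>.\<close>

lemma (in prob_space) prob_ball_lower_bound:
  fixes X :: "'a \<Rightarrow> 'b::euclidean_space"
  assumes X: "distributed M lborel X (\<lambda>x. ennreal (f x) * indicator S x)"
    and b: "0 < b" "\<And>x. x \<in> S \<Longrightarrow> b \<le> f x" and [measurable]: "S \<in> sets borel"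
    and reg: "c * measure lborel (cball z r) \<le> measure lborel (S \<inter> cball z r)" and r: "0 < r"
  shows "b * c * measure lborel (ball (0::'b) 1) * r ^ DIM('b) \<le> prob {\<omega>\<in>space M. X \<omega> \<in> S \<inter> cball z r}"
proof -
  have "measure lborel (cball z r) = measure lborel (ball (0::'b) 1) * r ^ DIM('b)"
    using r by (simp add: content_cball content_ball)
  then have "b * c * measure lborel (ball (0::'b) 1) * r ^ DIM('b)
      = b * (c * measure lborel (cball z r))" by (simp add: mult.assoc)
  also have "\<dots> \<le> b * measure lborel (S \<inter> cball z r)" using reg b by (intro mult_left_mono) auto
  also have "\<dots> \<le> prob {\<omega>\<in>space M. X \<omega> \<in> S \<inter> cball z r}"
  proof -
    have "emeasure lborel (S \<inter> cball z r) \<le> emeasure lborel (cball z r)"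
      by (intro emeasure_mono) auto
    also have "\<dots> < \<infinity>" using emeasure_lborel_cball_finite by blast
    finally have "ennreal b * emeasure lborel (S \<inter> cball z r) = ennreal (b * measure lborel (S \<inter> cball z r))"
      using b by (simp add: emeasure_eq_ennreal_measure ennreal_mult)
    then show ?thesis
      using distributed_lower_bound[OF X b(2), of "S \<inter> cball z r"] by (simp add: emeasure_eq_measure)
  qed
  finally show ?thesis .
qed

text \<open>For fixed prototypes the cell is a fixed Borel set, and the two tail lemmas apply to the
  sample with indices from 1 on; index 0 carries the law of the generic pair. The failure
  probabilities, \<open>\<delta>\<close> for the count and \<open>2 * \<delta>\<close> for the
  noise, are then integrated over the prototypes and added.\<close>

lemma (in prob_space) optinet_conditional_bounds:
  fixes D :: "nat \<Rightarrow> 'a \<Rightarrow> 'b::euclidean_space \<times> real"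
  assumes indep: "indep_vars (\<lambda>_. borel) D {0..n}"
    and id: "\<And>i. i \<in> {0..n} \<Longrightarrow> distr M borel (D i) = distr M borel (D 0)"
    and W: "indep_set (sets (vimage_algebra (space M) (\<lambda>\<omega>. \<lambda>i\<in>{0..n}. D i \<omega>) (PiM {0..n} (\<lambda>_. borel))))
               (sets (vimage_algebra (space M) W K))" "W \<in> measurable M K"
    and G: "{(y, w) \<in> space (borel \<Otimes>\<^sub>M K). y \<in> V w} \<in> sets (borel \<Otimes>\<^sub>M K)"
    and e: "e \<in> borel_measurable borel"
    and p: "AE \<omega> in M. q \<le> prob {\<omega>'\<in>space M. fst (D 0 \<omega>') \<in> V (W \<omega>)}"
    and mgf: "\<And>A t. A \<in> sets borel \<Longrightarrow>
      (\<integral>\<^sup>+\<omega>. ennreal (exp (t * e (D 0 \<omega>))) * indicator A (fst (D 0 \<omega>)) \<partial>M)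
        \<le> ennreal (exp (t\<^sup>2 * v / 2)) * (\<integral>\<^sup>+\<omega>. indicator A (fst (D 0 \<omega>)) \<partial>M)"
    and "0 \<le> v" "0 < \<delta>" "\<delta> < 1" and nq: "8 * ln (1 / \<delta>) \<le> real n * q"
  shows "\<exists>E\<in>events. emeasure M (space M - E) \<le> ennreal (3 * \<delta>) \<and>
    (\<forall>\<omega>\<in>E. real n * q / 2 \<le> (\<Sum>i=1..n. indicator (V (W \<omega>)) (fst (D i \<omega>))) \<and>
      \<bar>\<Sum>i=1..n. e (D i \<omega>) * indicator (V (W \<omega>)) (fst (D i \<omega>))\<bar>
        \<le> sqrt (2 * v * ln (1 / \<delta>) * (\<Sum>i=1..n. indicator (V (W \<omega>)) (fst (D i \<omega>)))))"
proof -
  let ?N = "PiM {0..n} (\<lambda>_. borel) :: (nat \<Rightarrow> 'b \<times> real) measure"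
  let ?G = "{(y, w) \<in> space (borel \<Otimes>\<^sub>M K). y \<in> V w}"
  define U where "U \<omega> = (\<lambda>i\<in>{0..n}. D i \<omega>)" for \<omega>
  have D[measurable]: "D i \<in> borel_measurable M" if "i \<in> {0..n}" for i
    using indep that by (auto simp: indep_vars_def)
  have U[measurable]: "U \<in> measurable M ?N"
    unfolding U_def by (intro measurable_restrict D)
  note W(2)[measurable] e[measurable]
  have fst_borel: "fst \<in> borel_measurable (borel :: ('b \<times> real) measure)"
    by (simp add: borel_prod[symmetric])
  have comp: "(\<lambda>p. fst p i) \<in> borel_measurable (?N \<Otimes>\<^sub>M K)" if "i \<in> {1..n}" for i
    using that by (intro measurable_compose[OF measurable_fst] measurable_component_singleton) auto
  \<comment> \<open>The indicator is taken of the joint set of pairs \<open>(y, w)\<close>, not of a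
    single cell, so that count and noise are measurable on the product space.\<close>
  define ind :: "nat \<Rightarrow> (nat \<Rightarrow> 'b \<times> real) \<times> 'c \<Rightarrow> real"
    where "ind i p = indicator ?G (fst (fst p i), snd p)" for i p
  have ind[measurable]: "ind i \<in> borel_measurable (?N \<Otimes>\<^sub>M K)" if "i \<in> {1..n}" for i
  proof -
    have "(\<lambda>p. (fst (fst p i), snd p)) \<in> measurable (?N \<Otimes>\<^sub>M K) (borel \<Otimes>\<^sub>M K)"
      using measurable_compose[OF comp[OF that] fst_borel] by (intro measurable_Pair) auto
    moreover have "indicator ?G \<in> borel_measurable (borel \<Otimes>\<^sub>M K)"
      using G by (rule borel_measurable_indicator)
    ultimately show ?thesis unfolding ind_def[abs_def] by (rule measurable_compose)
  qed
  have em[measurable]: "(\<lambda>p. e (fst p i)) \<in> borel_measurable (?N \<Otimes>\<^sub>M K)" if "i \<in> {1..n}" for i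
    by (rule measurable_compose[OF comp[OF that] e])
  have sec: "V w \<in> sets borel" if "w \<in> space K" for w
    using sets_Pair2[OF G, of w] that by (simp add: space_pair_measure)
  have ind_eq: "ind i (U \<omega>, w) = indicator (V w) (fst (D i \<omega>))" if "i \<in> {1..n}" "w \<in> space K" for i \<omega> w
    using that by (simp add: ind_def U_def space_pair_measure indicator_def)
  have e_eq: "e (U \<omega> i) = e (D i \<omega>)" if "i \<in> {1..n}" for i \<omega>
    using that by (simp add: U_def)
  let ?cnt = "\<lambda>p. \<Sum>i=1..n. ind i p"
  let ?noise = "\<lambda>p. \<Sum>i=1..n. e (fst p i) * ind i p"
  have [measurable]: "?cnt \<in> borel_measurable (?N \<Otimes>\<^sub>M K)" "?noise \<in> borel_measurable (?N \<Otimes>\<^sub>M K)"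
    by (intro borel_measurable_sum borel_measurable_times ind em; assumption)+
  define B1 where "B1 = {p\<in>space (?N \<Otimes>\<^sub>M K). ?cnt p < real n * q / 2}"
  define B2 where "B2 = {p\<in>space (?N \<Otimes>\<^sub>M K). sqrt (2 * v * ln (1 / \<delta>) * ?cnt p) < \<bar>?noise p\<bar>}"
  have [measurable]: "B1 \<in> sets (?N \<Otimes>\<^sub>M K)" "B2 \<in> sets (?N \<Otimes>\<^sub>M K)"
    unfolding B1_def B2_def by measurable
  have cnt_eq: "?cnt (U \<omega>, w) = (\<Sum>i\<in>{1..n}. indicator (V w \<times> UNIV) (D i \<omega>))"
    if "w \<in> space K" for \<omega> w
    using that by (intro sum.cong refl) (simp add: ind_eq indicator_def mem_Times_iff)
  have noise_eq: "?noise (U \<omega>, w) = (\<Sum>i\<in>{1..n}. e (D i \<omega>) * indicator (V w \<times> UNIV) (D i \<omega>))"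
    if "w \<in> space K" for \<omega> w
    using that by (intro sum.cong refl) (simp add: ind_eq e_eq indicator_def mem_Times_iff)
  have space: "(U \<omega>, w) \<in> space (?N \<Otimes>\<^sub>M K)" if "\<omega> \<in> space M" "w \<in> space K" for \<omega> w
    using that measurable_space[OF U] by (simp add: space_pair_measure)
  have indep1: "indep_vars (\<lambda>_. borel) D {1..n}"
    by (rule indep_vars_subset[OF indep]) auto
  have A: "V w \<times> UNIV \<in> sets (borel :: ('b \<times> real) measure)" if "w \<in> space K" for w
    using sec[OF that] by (simp add: borel_prod[symmetric])
  have "emeasure M {\<omega>\<in>space M. (U \<omega>, W \<omega>) \<in> B1} \<le> ennreal \<delta>"
  proof (rule emeasure_le_of_sections_le[OF W(1)[folded U_def] U W(2)])
    show "AE \<omega> in M. emeasure M {\<omega>'\<in>space M. (U \<omega>', W \<omega>) \<in> B1} \<le> ennreal \<delta>"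
      using p
    proof (rule AE_mp, intro AE_I2 impI)
      fix \<omega> assume "\<omega> \<in> space M" and q: "q \<le> prob {\<omega>'\<in>space M. fst (D 0 \<omega>') \<in> V (W \<omega>)}"
      then have w: "W \<omega> \<in> space K" by (intro measurable_space[OF W(2)])
      have "q \<le> prob {\<omega>'\<in>space M. D i \<omega>' \<in> V (W \<omega>) \<times> UNIV}" if "i \<in> {1..n}" for i
        using q prob_identically_distributed[OF id D D A[OF w], of i] that
        by (simp add: mem_Times_iff)
      then have "emeasure M {\<omega>'\<in>space M. (\<Sum>i\<in>{1..n}. indicator (V (W \<omega>) \<times> UNIV) (D i \<omega>'))
          < real (card {1..n}) * q / 2} \<le> ennreal (exp (- (real (card {1..n}) * q / 8)))"
        by (intro count_in_set_lower_tail[OF _ indep1 A[OF w]]) auto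
      \<comment> \<open>The factor 8 in \<open>nq\<close> matches the 8 in the exponent of the count
        bound, so that the failure probability becomes \<open>\<delta>\<close>.\<close>
      also have "\<dots> \<le> ennreal (exp (- ln (1 / \<delta>)))" using nq by (intro ennreal_leI) simp
      also have "exp (- ln (1 / \<delta>)) = \<delta>" using \<open>0 < \<delta>\<close> by (simp add: ln_div)
      also have "{\<omega>'\<in>space M. (\<Sum>i\<in>{1..n}. indicator (V (W \<omega>) \<times> UNIV) (D i \<omega>'))
          < real (card {1..n}) * q / 2} = {\<omega>'\<in>space M. (U \<omega>', W \<omega>) \<in> B1}"
        by (rule Collect_cong) (simp only: B1_def cnt_eq[OF w] space[OF _ w] mem_Collect_eq simp_thms card_atLeastAtMost diff_Suc_1 cong: conj_cong)
      finally show "emeasure M {\<omega>'\<in>space M. (U \<omega>', W \<omega>) \<in> B1} \<le> ennreal \<delta>" .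
    qed
  qed measurable
  moreover have "emeasure M {\<omega>\<in>space M. (U \<omega>, W \<omega>) \<in> B2} \<le> ennreal (2 * \<delta>)"
  proof (rule emeasure_le_of_sections_le[OF W(1)[folded U_def] U W(2)])
    show "AE \<omega> in M. emeasure M {\<omega>'\<in>space M. (U \<omega>', W \<omega>) \<in> B2} \<le> ennreal (2 * \<delta>)"
    proof (rule AE_I2)
      fix \<omega> assume "\<omega> \<in> space M"
      then have w: "W \<omega> \<in> space K" by (intro measurable_space[OF W(2)])
      note [measurable] = A[OF w]
      \<comment> \<open>The moment bound is given for the generic pair \<open>D 0\<close>; equality
        of laws carries it to \<open>D i\<close>.\<close>
      have mgf_i: "(\<integral>\<^sup>+\<omega>'. ennreal (exp (t * e (D i \<omega>'))) * indicator (V (W \<omega>) \<times> UNIV) (D i \<omega>') \<partial>M)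
        \<le> ennreal (exp (t\<^sup>2 * v / 2)) * (\<integral>\<^sup>+\<omega>'. indicator (V (W \<omega>) \<times> UNIV) (D i \<omega>') \<partial>M)"
        if i: "i \<in> {1..n}" for i t
      proof -
        have Di: "distr M borel (D i) = distr M borel (D 0)" "D i \<in> borel_measurable M" "D 0 \<in> borel_measurable M"
          using i by (auto intro: id D)
        have "(\<integral>\<^sup>+\<omega>'. ennreal (exp (t * e (D i \<omega>'))) * indicator (V (W \<omega>) \<times> UNIV) (D i \<omega>') \<partial>M)
          = (\<integral>\<^sup>+\<omega>'. ennreal (exp (t * e (D 0 \<omega>'))) * indicator (V (W \<omega>) \<times> UNIV) (D 0 \<omega>') \<partial>M)"
          by (rule nn_integral_identically_distributed[OF Di,
              of "\<lambda>z. ennreal (exp (t * e z)) * indicator (V (W \<omega>) \<times> UNIV) z"]) measurable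
        moreover have "(\<integral>\<^sup>+\<omega>'. indicator (V (W \<omega>) \<times> UNIV) (D i \<omega>') \<partial>M)
          = (\<integral>\<^sup>+\<omega>'. indicator (V (W \<omega>) \<times> UNIV) (D 0 \<omega>') \<partial>M)"
          by (rule nn_integral_identically_distributed[OF Di]) measurable
        moreover have "indicator (V (W \<omega>) \<times> UNIV) z = (indicator (V (W \<omega>)) (fst z) :: ennreal)" for z :: "'b \<times> real"
          by (simp add: indicator_def mem_Times_iff)
        ultimately show ?thesis using mgf[OF sec[OF w], of t] by (simp only:)
      qed
      have "emeasure M {\<omega>'\<in>space M.
          sqrt (2 * v * ln (1 / \<delta>) * (\<Sum>i\<in>{1..n}. indicator (V (W \<omega>) \<times> UNIV) (D i \<omega>')))
          < \<bar>\<Sum>i\<in>{1..n}. e (D i \<omega>') * indicator (V (W \<omega>) \<times> UNIV) (D i \<omega>')\<bar>} \<le> ennreal (2 * \<delta>)"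
        using \<open>0 \<le> v\<close> \<open>0 < \<delta>\<close> \<open>\<delta> < 1\<close>
        by (intro subgaussian_sum_over_set_tail[OF _ indep1 A[OF w] e] mgf_i) auto
      also have "{\<omega>'\<in>space M.
          sqrt (2 * v * ln (1 / \<delta>) * (\<Sum>i\<in>{1..n}. indicator (V (W \<omega>) \<times> UNIV) (D i \<omega>')))
          < \<bar>\<Sum>i\<in>{1..n}. e (D i \<omega>') * indicator (V (W \<omega>) \<times> UNIV) (D i \<omega>')\<bar>}
          = {\<omega>'\<in>space M. (U \<omega>', W \<omega>) \<in> B2}"
        by (rule Collect_cong) (simp only: B2_def cnt_eq[OF w] noise_eq[OF w] space[OF _ w] mem_Collect_eq simp_thms cong: conj_cong)
      finally show "emeasure M {\<omega>'\<in>space M. (U \<omega>', W \<omega>) \<in> B2} \<le> ennreal (2 * \<delta>)" .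
    qed
  qed measurable
  ultimately have sum: "emeasure M {\<omega>\<in>space M. (U \<omega>, W \<omega>) \<in> B1} + emeasure M {\<omega>\<in>space M. (U \<omega>, W \<omega>) \<in> B2}
      \<le> ennreal \<delta> + ennreal (2 * \<delta>)" by (rule add_mono)
  define E where "E = {\<omega>\<in>space M. (U \<omega>, W \<omega>) \<notin> B1 \<and> (U \<omega>, W \<omega>) \<notin> B2}"
  have "E \<in> events" unfolding E_def by measurable
  have "space M - E = {\<omega>\<in>space M. (U \<omega>, W \<omega>) \<in> B1} \<union> {\<omega>\<in>space M. (U \<omega>, W \<omega>) \<in> B2}"
    by (auto simp: E_def)
  then have "emeasure M (space M - E) \<le> ennreal \<delta> + ennreal (2 * \<delta>)"
    using sum emeasure_subadditive[of "{\<omega>\<in>space M. (U \<omega>, W \<omega>) \<in> B1}" M "{\<omega>\<in>space M. (U \<omega>, W \<omega>) \<in> B2}"]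
    by (simp only:) (erule order_trans[rotated], measurable)
  also have "\<dots> = ennreal (3 * \<delta>)" using \<open>0 < \<delta>\<close> by (simp add: ennreal_plus[symmetric] del: ennreal_plus)
  finally have *: "emeasure M (space M - E) \<le> ennreal (3 * \<delta>)" .
  show ?thesis
  proof (intro bexI[OF _ \<open>E \<in> events\<close>] conjI ballI *)
    fix \<omega> assume "\<omega> \<in> E"
    then have \<omega>: "\<omega> \<in> space M" "(U \<omega>, W \<omega>) \<notin> B1" "(U \<omega>, W \<omega>) \<notin> B2" by (auto simp: E_def)
    then have w: "W \<omega> \<in> space K" by (intro measurable_space[OF W(2)])
    have i: "indicator (V (W \<omega>) \<times> UNIV) z = (indicator (V (W \<omega>)) (fst z) :: real)" for z :: "'b \<times> real"
      by (simp add: indicator_def mem_Times_iff)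
    show "real n * q / 2 \<le> (\<Sum>i=1..n. indicator (V (W \<omega>)) (fst (D i \<omega>)))"
      using \<omega>(2) space[OF \<omega>(1) w] unfolding B1_def mem_Collect_eq cnt_eq[OF w] i by linarith
    show "\<bar>\<Sum>i=1..n. e (D i \<omega>) * indicator (V (W \<omega>)) (fst (D i \<omega>))\<bar>
        \<le> sqrt (2 * v * ln (1 / \<delta>) * (\<Sum>i=1..n. indicator (V (W \<omega>)) (fst (D i \<omega>))))"
      using \<omega>(3) space[OF \<omega>(1) w] unfolding B2_def mem_Collect_eq cnt_eq[OF w] noise_eq[OF w] i by linarith
  qed
qed

section \<open>Combination of the three events\<close>

theorem theorem17:
  fixes P :: "'w measure"
    and X :: "nat \<Rightarrow> 'w \<Rightarrow> 'a::euclidean_space" and Y :: "nat \<Rightarrow> 'w \<Rightarrow> real"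
    and Z :: "nat \<Rightarrow> 'w \<Rightarrow> 'a"
    and S :: "'a set" and g f :: "'a \<Rightarrow> real"
    and L \<sigma> \<rho>0 T0 c b M \<delta> \<eta> V\<^sub>d :: real and n m d :: nat
    and sel :: "(nat \<Rightarrow> 'a) \<Rightarrow> nat list" and \<kappa> :: "nat set \<Rightarrow> nat"
  assumes "d = DIM('a)" and "V\<^sub>d = measure lborel (ball (0::'a) 1)"
    and "prob_space P"
    and "iid P (\<lambda>i \<omega>. (X i \<omega>, Y i \<omega>)) {0..n}"
    and "iid P Z {0..m}" and "distr P borel (Z 0) = distr P borel (X 0)"
    and "indep_families P (\<lambda>i \<omega>. (X i \<omega>, Y i \<omega>)) {0..n} Z {0..m}"
    and "\<And>\<omega>. \<omega> \<in> space P \<Longrightarrow> X 0 \<omega> \<in> S"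
    and "regression_function P (X 0) (Y 0) g"
    and "L-lipschitz_on S g"
    and "subgaussian_given P (sigma_gen P (\<lambda>\<omega>. (X 0 \<omega>, Z 0 \<omega>))) (\<sigma>\<^sup>2)
           (\<lambda>\<omega>. Y 0 \<omega> - g (X 0 \<omega>))"
    and "S \<in> sets borel"
    and "\<rho>0 > 0" and "S \<subseteq> cball 0 \<rho>0"
    and "c > 0" and "T0 > 0" and "T0 = \<rho>0"
    and "\<And>\<tau> x. 0 < \<tau> \<Longrightarrow> \<tau> \<le> T0 \<Longrightarrow> x \<in> S \<Longrightarrow>
           measure lborel (S \<inter> cball x \<tau>) \<ge> c * measure lborel (cball x \<tau>)"
    and "distributed P lborel (X 0) (\<lambda>x. ennreal (f x) * indicator S x)"
    and "b > 0" and "\<And>x. x \<in> S \<Longrightarrow> b \<le> f x \<and> f x \<le> M"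
    and "net_selector \<eta> m sel" and "tie_rule \<kappa>"
    and "0 < \<delta>" and "\<delta> < 1/4" and "n \<ge> 1" and "m \<ge> 1" and "\<eta> > 0"
    and "32 * real d * ln (12 * real m / \<delta>) \<le> T0 ^ d * real m * b * c * V\<^sub>d"
    and "\<eta> \<le> 2 * T0"
    and "real n * b * V\<^sub>d * c * \<eta> ^ d \<ge> 2 ^ (d + 3) * ln (1 / \<delta>)"
  shows "\<forall>x\<in>S. \<exists>E \<in> sets P. measure P E \<ge> 1 - 4 * \<delta> \<and>
           (\<forall>\<omega>\<in>E.
              let V = voronoi_cell \<kappa> S (net_points sel m (\<lambda>j. Z j \<omega>)) x
              in \<bar>local_average n (\<lambda>i. X i \<omega>) (\<lambda>i. Y i \<omega>) V - g x\<bar>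
                 \<le> sqrt (2 ^ (d + 2) * \<sigma>\<^sup>2 * ln (1 / \<delta>) / (real n * b * V\<^sub>d * c * \<eta> ^ d))
                   + 2 * lip_const g V *
                     (\<eta> + root d (32 * real d * ln (12 * real m / \<delta>) / (real m * b * c * V\<^sub>d))))"
proof
  fix x assume x: "x \<in> S"
  interpret prob_space P by fact
  define D where "D i \<omega> = (X i \<omega>, Y i \<omega>)" for i \<omega>
  define k where "k = b * c * V\<^sub>d"
  \<comment> \<open>\<open>q\<close> bounds below the mass of the points of \<open>S\<close> in a
    ball of radius \<open>\<eta> / 2\<close> centered in \<open>S\<close>; the radius is admissible
    since \<open>\<eta> \<le> 2 * T0\<close>.\<close>
  define q where "q = k * (\<eta> / 2) ^ d"
  define \<tau> where "\<tau> = root d (32 * real d * ln (12 * real m / \<delta>) / (real m * k))"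
  \<comment> \<open>\<open>g'\<close> agrees with \<open>g\<close> on \<open>S\<close> and, unlike
    \<open>g\<close> itself, is known to be measurable on the whole space, which makes the noise a
    measurable function \<open>e\<close> of the pair.\<close>
  define g' where "g' y = (if y \<in> S then g y else 0)" for y
  define e where "e z = snd z - g' (fst z)" for z :: "'a \<times> real"
  define K where "K = PiM {0..m} (\<lambda>_. borel :: 'a measure)"
  define W where "W \<omega> = (\<lambda>j\<in>{0..m}. Z j \<omega>)" for \<omega>
  define V where "V w = voronoi_cell \<kappa> S (net_points sel m w) x" for w
  have d: "1 \<le> d" using assms(1) DIM_positive[where 'a = 'a] by simp
  have Vd: "0 < V\<^sub>d" using assms(2) by simp
  have k: "0 < k" using assms(15,20) Vd by (simp add: k_def)
  have q: "0 < q" using k assms(28) by (simp add: q_def)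
  have D_eq: "(\<lambda>i \<omega>. (X i \<omega>, Y i \<omega>)) = D" by (simp add: D_def fun_eq_iff)
  note iidD = assms(4)[unfolded D_eq iid_def identically_distributed_def]
  note iidZ = assms(5)[unfolded iid_def identically_distributed_def]
  note indepD = iidD[THEN conjunct1] and indepZ = iidZ[THEN conjunct1]
  have idD: "distr P borel (D i) = distr P borel (D 0)" if "i \<in> {0..n}" for i
    using iidD[THEN conjunct2, rule_format, OF that, of 0] by simp
  have idZ: "distr P borel (Z j) = distr P borel (X 0)" if "j \<in> {0..m}" for j
    using iidZ[THEN conjunct2, rule_format, OF that, of 0] assms(6) by simp
  have D: "D i \<in> borel_measurable P" if "i \<in> {0..n}" for i
    using indepD that by (auto simp: indep_vars_def)
  have Z[measurable]: "Z j \<in> borel_measurable P" if "j \<in> {0..m}" for j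
    using indepZ that by (auto simp: indep_vars_def)
  have fst_borel: "fst \<in> borel_measurable (borel :: ('a \<times> real) measure)"
    and snd_borel: "snd \<in> borel_measurable (borel :: ('a \<times> real) measure)"
    by (simp_all add: borel_prod[symmetric])
  have X[measurable]: "X i \<in> borel_measurable P" if "i \<in> {0..n}" for i
    using measurable_compose[OF D[OF that] fst_borel] by (simp add: D_def)
  note [measurable] = \<open>S \<in> sets borel\<close>
  \<comment> \<open>Only \<open>X 0\<close> is assumed to take all its values in \<open>S\<close>;
    the other vectors share its law and hence lie in \<open>S\<close> almost surely.\<close>
  have in_S: "AE \<omega> in P. U \<omega> \<in> S"
    if "distr P borel U = distr P borel (X 0)" "U \<in> borel_measurable P" for U
  proof -
    have "prob {\<omega>\<in>space P. U \<omega> \<in> S} = prob {\<omega>\<in>space P. X 0 \<omega> \<in> S}"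
      using that by (intro prob_identically_distributed[where N = borel]) auto
    also have "{\<omega>\<in>space P. X 0 \<omega> \<in> S} = space P" using assms(8) by auto
    finally have "prob {\<omega>\<in>space P. U \<omega> \<in> S} = 1" by (simp add: prob_space)
    moreover have "{\<omega>\<in>space P. U \<omega> \<in> S} \<in> events" using that by measurable
    ultimately show ?thesis using prob_Collect_eq_1[of "\<lambda>\<omega>. U \<omega> \<in> S"] by simp
  qed
  have Z_in_S: "AE \<omega> in P. \<forall>j\<in>{1..m}. Z j \<omega> \<in> S"
    by (intro AE_finite_allI in_S idZ Z) auto
  have X_in_S: "AE \<omega> in P. \<forall>i\<in>{1..n}. X i \<omega> \<in> S"
  proof (intro AE_finite_allI in_S)
    fix i assume i: "i \<in> {1..n}"
    have "distr P borel (\<lambda>\<omega>. fst (D i \<omega>)) = distr (distr P borel (D i)) borel fst"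
      using i by (subst distr_distr[OF fst_borel D]) (auto simp: comp_def)
    also have "distr P borel (D i) = distr P borel (D 0)" using i by (intro idD) auto
    also have "distr (distr P borel (D 0)) borel fst = distr P borel (\<lambda>\<omega>. fst (D 0 \<omega>))"
      by (subst distr_distr[OF fst_borel D]) (auto simp: comp_def)
    finally show "distr P borel (X i) = distr P borel (X 0)" by (simp add: D_def)
  qed (use X in auto)
  have mass: "k * r ^ d \<le> prob {\<omega>\<in>space P. X 0 \<omega> \<in> S \<inter> cball z r}"
    if "z \<in> S" "0 < r" "r \<le> T0" for z r
    unfolding k_def assms(1,2)
    by (rule prob_ball_lower_bound[OF assms(19,20) _ _ assms(18)]) (use assms(21) that in auto)
  have e: "e \<in> borel_measurable borel"
  proof -
    have "g' \<in> borel_measurable borel"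
      unfolding g'_def[abs_def] by (rule borel_measurable_if_lipschitz_on[OF assms(10,12)])
    then have "(\<lambda>z :: 'a \<times> real. g' (fst z)) \<in> borel_measurable borel"
      using fst_borel by (rule measurable_compose[rotated])
    then show ?thesis unfolding e_def[abs_def] using snd_borel by (intro borel_measurable_diff)
  qed
  have \<sigma>mgf: "(\<integral>\<^sup>+\<omega>. ennreal (exp (t * e (D 0 \<omega>))) * indicator A (fst (D 0 \<omega>)) \<partial>P)
        \<le> ennreal (exp (t\<^sup>2 * \<sigma>\<^sup>2 / 2)) * (\<integral>\<^sup>+\<omega>. indicator A (fst (D 0 \<omega>)) \<partial>P)"
    if "A \<in> sets borel" for A t
  proof -
    have XZ: "(\<lambda>\<omega>. (X 0 \<omega>, Z 0 \<omega>)) \<in> borel_measurable P"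
      unfolding borel_prod[symmetric] using X Z by (intro measurable_Pair) auto
    \<comment> \<open>The noise is controlled given \<open>X 0\<close> and \<open>Z 0\<close>
      jointly; a test set that leaves \<open>Z 0\<close> free yields a statement about the pair
      \<open>D 0\<close> alone.\<close>
    have "A \<times> (UNIV :: 'a set) \<in> sets borel" using that by (simp add: borel_prod[symmetric])
    from subgaussian_given_mgf_on[OF assms(11) XZ this, of t]
    have "(\<integral>\<^sup>+\<omega>. ennreal (exp (t * (Y 0 \<omega> - g (X 0 \<omega>)))) * indicator A (X 0 \<omega>) \<partial>P)
      \<le> ennreal (exp (t\<^sup>2 * \<sigma>\<^sup>2 / 2)) * (\<integral>\<^sup>+\<omega>. indicator A (X 0 \<omega>) \<partial>P)"
      by (simp add: indicator_times)
    also have "(\<integral>\<^sup>+\<omega>. ennreal (exp (t * (Y 0 \<omega> - g (X 0 \<omega>)))) * indicator A (X 0 \<omega>) \<partial>P)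
      = (\<integral>\<^sup>+\<omega>. ennreal (exp (t * e (D 0 \<omega>))) * indicator A (fst (D 0 \<omega>)) \<partial>P)"
      by (intro nn_integral_cong) (simp add: e_def D_def g'_def assms(8))
    finally show ?thesis by (simp add: D_def)
  qed
  have W: "W \<in> measurable P K" unfolding W_def K_def by (intro measurable_restrict Z)
  have G: "{(y, w) \<in> space (borel \<Otimes>\<^sub>M K). y \<in> V w} \<in> sets (borel \<Otimes>\<^sub>M K)"
    unfolding V_def K_def using measurable_voronoi_cell_of_prototypes[OF assms(22,12)] by auto
  have indepW: "indep_set (sets (vimage_algebra (space P) (\<lambda>\<omega>. \<lambda>i\<in>{0..n}. D i \<omega>) (PiM {0..n} (\<lambda>_. borel))))
      (sets (vimage_algebra (space P) W K))"
    using assms(7) unfolding indep_families_def D_def W_def K_def .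
  have net: "net_points sel m (W \<omega>) = net_points sel m (\<lambda>j. Z j \<omega>)" for \<omega>
  proof -
    have "restrict (W \<omega>) {1..m} = restrict (\<lambda>j. Z j \<omega>) {1..m}" by (auto simp: W_def)
    then show ?thesis by (simp only: net_points_def)
  qed
  define ps where "ps \<omega> = net_points sel m (\<lambda>j. Z j \<omega>)" for \<omega>
  note ps = net_points_properties[OF assms(22,27,28), where w = "\<lambda>j. Z j \<omega>" for \<omega>, folded ps_def]
  have VW: "V (W \<omega>) = voronoi_cell \<kappa> S (ps \<omega>) x" for \<omega> by (simp only: V_def net ps_def)
  have V_borel: "V (W \<omega>) \<in> sets borel" if "\<omega> \<in> space P" for \<omega>
    using sets_Pair2[OF G, of "W \<omega>"] measurable_space[OF W that] by (simp add: space_pair_measure)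
  \<comment> \<open>The bound holds almost surely: the center of the cell is a prototype, and the
    mass bound requires it to lie in \<open>S\<close>.\<close>
  have cell_mass: "AE \<omega> in P. q \<le> prob {\<omega>'\<in>space P. fst (D 0 \<omega>') \<in> V (W \<omega>)}"
    using Z_in_S
  proof (rule AE_mp, intro AE_I2 impI)
    fix \<omega> assume \<omega>: "\<omega> \<in> space P" and zS: "\<forall>j\<in>{1..m}. Z j \<omega> \<in> S"
    let ?p = "ps \<omega> ! nearest_index \<kappa> (ps \<omega>) x"
    have "?p \<in> set (ps \<omega>)" using nearest_index_minimal(1)[OF assms(23) ps(1)] by (rule nth_mem)
    then have "?p \<in> (\<lambda>j. Z j \<omega>) ` {1..m}" by (rule subsetD[OF ps(4)])
    then have "?p \<in> S" using zS by (elim imageE) simp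
    then have "q \<le> prob {\<omega>'\<in>space P. X 0 \<omega>' \<in> S \<inter> cball ?p (\<eta> / 2)}"
      unfolding q_def using assms(28,30) by (intro mass) auto
    also have "\<dots> \<le> prob {\<omega>'\<in>space P. X 0 \<omega>' \<in> V (W \<omega>)}"
    proof (rule finite_measure_mono)
      show "{\<omega>'\<in>space P. X 0 \<omega>' \<in> S \<inter> cball ?p (\<eta> / 2)} \<subseteq> {\<omega>'\<in>space P. X 0 \<omega>' \<in> V (W \<omega>)}"
        using ball_subset_voronoi_cell[OF assms(23) ps(1-3)] unfolding VW by blast
      have "X 0 -` V (W \<omega>) \<inter> space P \<in> events" using X V_borel[OF \<omega>] by (intro measurable_sets) auto
      then show "{\<omega>'\<in>space P. X 0 \<omega>' \<in> V (W \<omega>)} \<in> events" by (simp add: vimage_def Int_def conj_commute)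
    qed
    finally show "q \<le> prob {\<omega>'\<in>space P. fst (D 0 \<omega>') \<in> V (W \<omega>)}" by (simp add: D_def)
  qed
  have nq: "real n * q = real n * b * V\<^sub>d * c * \<eta> ^ d / 2 ^ d"
    by (simp add: q_def k_def power_divide)
  \<comment> \<open>Halving the radius costs \<open>2 ^ d\<close>, and
    \<open>2 ^ (d + 3) / 2 ^ d = 8\<close> is the constant that the count bound requires.\<close>
  have nq8: "8 * ln (1 / \<delta>) \<le> real n * q"
    unfolding nq using assms(31) by (simp add: power_add field_simps)
  have "\<exists>E\<in>events. emeasure P (space P - E) \<le> ennreal (3 * \<delta>) \<and>
    (\<forall>\<omega>\<in>E. real n * q / 2 \<le> (\<Sum>i=1..n. indicator (V (W \<omega>)) (fst (D i \<omega>))) \<and>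
      \<bar>\<Sum>i=1..n. e (D i \<omega>) * indicator (V (W \<omega>)) (fst (D i \<omega>))\<bar>
        \<le> sqrt (2 * \<sigma>\<^sup>2 * ln (1 / \<delta>) * (\<Sum>i=1..n. indicator (V (W \<omega>)) (fst (D i \<omega>)))))"
    using assms(24,25)
    by (intro optinet_conditional_bounds[where K = K and v = "\<sigma>\<^sup>2"]
        indepD idD indepW W G e cell_mass \<sigma>mgf nq8) auto
  then obtain E1 where E1: "E1 \<in> events" "emeasure P (space P - E1) \<le> ennreal (3 * \<delta>)"
    and E1_cnt: "\<And>\<omega>. \<omega> \<in> E1 \<Longrightarrow> real n * q / 2 \<le> (\<Sum>i=1..n. indicator (V (W \<omega>)) (fst (D i \<omega>)))"
    and E1_noise: "\<And>\<omega>. \<omega> \<in> E1 \<Longrightarrow> \<bar>\<Sum>i=1..n. e (D i \<omega>) * indicator (V (W \<omega>)) (fst (D i \<omega>))\<bar>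
        \<le> sqrt (2 * \<sigma>\<^sup>2 * ln (1 / \<delta>) * (\<Sum>i=1..n. indicator (V (W \<omega>)) (fst (D i \<omega>))))"
    by blast
  have "\<exists>E\<in>events. emeasure P (space P - E) \<le> ennreal \<delta> \<and>
      (\<forall>\<omega>\<in>E. \<forall>y\<in>S. \<exists>j\<in>{1..m}. dist y (Z j \<omega>) \<le> \<tau>)"
    unfolding \<tau>_def
  proof (rule sample_dense_in_support)
    show "indep_vars (\<lambda>_. borel) Z {1..m}" by (rule indep_vars_subset[OF indepZ]) auto
    show "32 * real d * ln (12 * real m / \<delta>) \<le> T0 ^ d * real m * k"
      using assms(29) by (simp add: k_def mult.assoc)
    fix j z and r :: real assume j: "j \<in> {1..m}" and z: "z \<in> S" "0 < r" "r \<le> T0"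
    have "k * r ^ d \<le> prob {\<omega>\<in>space P. X 0 \<omega> \<in> S \<inter> cball z r}" by (rule mass[OF z])
    also have "\<dots> \<le> prob {\<omega>\<in>space P. X 0 \<omega> \<in> cball z r}"
      using X by (intro finite_measure_mono) auto
    also have "\<dots> = prob {\<omega>\<in>space P. Z j \<omega> \<in> cball z r}"
      using j X by (intro prob_identically_distributed[OF idZ[symmetric]]) auto
    finally show "k * r ^ d \<le> prob {\<omega>\<in>space P. Z j \<omega> \<in> cball z r}" .
  qed (use assms(16,24,25,27) d k x in auto)
  then obtain E2 where E2: "E2 \<in> events" "emeasure P (space P - E2) \<le> ennreal \<delta>"
    and E2_dense: "\<And>\<omega> y. \<omega> \<in> E2 \<Longrightarrow> y \<in> S \<Longrightarrow> \<exists>j\<in>{1..m}. dist y (Z j \<omega>) \<le> \<tau>"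
    by blast
  \<comment> \<open>On \<open>E0\<close> the extension \<open>g'\<close> agrees with
    \<open>g\<close> at every sample point, so \<open>e (D i \<omega>)\<close> is the true
    noise.\<close>
  define E0 where "E0 = {\<omega>\<in>space P. \<forall>i\<in>{1..n}. X i \<omega> \<in> S}"
  have E0: "E0 \<in> events"
    unfolding E0_def by (intro sets.sets_Collect_finite_All) (use X in auto)
  define E where "E = E0 \<inter> E1 \<inter> E2"
  have E: "E \<in> events" using E0 E1 E2 by (simp add: E_def)
  \<comment> \<open>The failure probabilities of \<open>E0\<close>, \<open>E1\<close> and
    \<open>E2\<close> are at most 0, \<open>3 * \<delta>\<close> and
    \<open>\<delta>\<close>.\<close>
  have "prob E \<ge> 1 - 4 * \<delta>"
  proof -
    have "prob E0 = 1" unfolding E0_def using X_in_S E0[unfolded E0_def] by (simp add: prob_Collect_eq_1)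
    then have "prob (space P - E0) = 0" using E0 by (simp add: prob_compl)
    moreover have "prob (space P - E1) \<le> 3 * \<delta>" "prob (space P - E2) \<le> \<delta>"
      using E1(2) E2(2) assms(24) by (simp_all add: emeasure_eq_measure)
    moreover have "prob (space P - E) \<le> prob (space P - E0) + (prob (space P - E1) + prob (space P - E2))"
    proof -
      have "space P - E = (space P - E0) \<union> ((space P - E1) \<union> (space P - E2))" by (auto simp: E_def)
      moreover have "prob ((space P - E0) \<union> ((space P - E1) \<union> (space P - E2)))
          \<le> prob (space P - E0) + prob ((space P - E1) \<union> (space P - E2))"
        using E0 E1 E2 by (intro measure_Un_le) auto
      moreover have "prob ((space P - E1) \<union> (space P - E2)) \<le> prob (space P - E1) + prob (space P - E2)"
        using E1 E2 by (intro measure_Un_le) auto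
      ultimately show ?thesis by simp
    qed
    ultimately show ?thesis using prob_compl[OF E] by linarith
  qed
  moreover have "\<bar>local_average n (\<lambda>i. X i \<omega>) (\<lambda>i. Y i \<omega>) (V (W \<omega>)) - g x\<bar>
      \<le> sqrt (2 ^ (d + 2) * \<sigma>\<^sup>2 * ln (1 / \<delta>) / (real n * b * V\<^sub>d * c * \<eta> ^ d))
        + 2 * lip_const g (V (W \<omega>)) * (\<eta> + \<tau>)"
    if "\<omega> \<in> E" for \<omega>
  proof -
    have \<omega>: "\<omega> \<in> E0" "\<omega> \<in> E1" "\<omega> \<in> E2" using that by (auto simp: E_def)
    have VS: "V (W \<omega>) \<subseteq> S" by (auto simp: VW voronoi_cell_def)
    have "\<bar>local_average n (\<lambda>i. X i \<omega>) (\<lambda>i. Y i \<omega>) (V (W \<omega>)) - g x\<bar>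
      \<le> sqrt (2 * \<sigma>\<^sup>2 * ln (1 / \<delta>) / (real n * q / 2)) + lip_const g (V (W \<omega>)) * (2 * (\<eta> + \<tau>))"
    proof (rule local_average_error_le[OF _ _ _ refl])
      show "(lip_const g (V (W \<omega>)))-lipschitz_on (V (W \<omega>)) g"
        by (rule lipschitz_on_lip_const[OF lipschitz_on_subset[OF assms(10) VS]])
      show "x \<in> V (W \<omega>)" using x by (simp add: VW voronoi_cell_def)
      \<comment> \<open>The distance is at most \<open>\<tau>\<close> to some prototype, and then at
        most \<open>\<eta>\<close> from there to the net.\<close>
      have near: "\<exists>p\<in>set (ps \<omega>). dist y p \<le> \<eta> + \<tau>" if "y \<in> S" for y
        using E2_dense[OF \<omega>(3) that] ps(5) by blast
      show "dist y x \<le> 2 * (\<eta> + \<tau>)" if "y \<in> V (W \<omega>)" for y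
        using dist_voronoi_cell_le[OF assms(23) ps(1) near x that[unfolded VW]] .
      show "real n * q / 2 \<le> (\<Sum>i=1..n. indicator (V (W \<omega>)) (X i \<omega>))"
        using E1_cnt[OF \<omega>(2)] by (simp only: D_def fst_conv)
      show "0 < real n * q / 2" using assms(26) q by simp
      show "0 \<le> 2 * \<sigma>\<^sup>2 * ln (1 / \<delta>)" using assms(24,25) by simp
      have "(\<Sum>i=1..n. (Y i \<omega> - g (X i \<omega>)) * indicator (V (W \<omega>)) (X i \<omega>))
          = (\<Sum>i=1..n. e (D i \<omega>) * indicator (V (W \<omega>)) (fst (D i \<omega>)))"
        using \<omega>(1) by (intro sum.cong) (auto simp: E0_def e_def D_def g'_def)
      then show "\<bar>\<Sum>i=1..n. (Y i \<omega> - g (X i \<omega>)) * indicator (V (W \<omega>)) (X i \<omega>)\<bar>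
        \<le> sqrt (2 * \<sigma>\<^sup>2 * ln (1 / \<delta>) * (\<Sum>i=1..n. indicator (V (W \<omega>)) (X i \<omega>)))"
        using E1_noise[OF \<omega>(2)] by (simp only: D_def fst_conv)
    qed
    \<comment> \<open>The power \<open>2 ^ (d + 2)\<close> collects \<open>2 ^ d\<close> from the
      radius \<open>\<eta> / 2\<close>, a factor 2 from using half of the expected count, and the 2
      of the sub-Gaussian tail.\<close>
    also have "2 * \<sigma>\<^sup>2 * ln (1 / \<delta>) / (real n * q / 2)
        = 2 ^ (d + 2) * \<sigma>\<^sup>2 * ln (1 / \<delta>) / (real n * b * V\<^sub>d * c * \<eta> ^ d)"
      unfolding nq by (simp add: power_add)
    also have "lip_const g (V (W \<omega>)) * (2 * (\<eta> + \<tau>)) = 2 * lip_const g (V (W \<omega>)) * (\<eta> + \<tau>)"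
      by (simp only: mult_ac)
    finally show ?thesis .
  qed
  ultimately show "\<exists>E \<in> sets P. measure P E \<ge> 1 - 4 * \<delta> \<and>
           (\<forall>\<omega>\<in>E.
              let V = voronoi_cell \<kappa> S (net_points sel m (\<lambda>j. Z j \<omega>)) x
              in \<bar>local_average n (\<lambda>i. X i \<omega>) (\<lambda>i. Y i \<omega>) V - g x\<bar>
                 \<le> sqrt (2 ^ (d + 2) * \<sigma>\<^sup>2 * ln (1 / \<delta>) / (real n * b * V\<^sub>d * c * \<eta> ^ d))
                   + 2 * lip_const g V *
                     (\<eta> + root d (32 * real d * ln (12 * real m / \<delta>) / (real m * b * c * V\<^sub>d))))"
    using E by (intro bexI[of _ E]) (simp_all add: Let_def V_def net \<tau>_def k_def mult.assoc)
qed

end
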